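(* For every $s\ge\frac12$ there is a constant $C$ (depending only on $s$) such that for all $u_1,u_2\in Z^{s-1,\frac12}$, $$\|\mathbb{P}(u_1)\mathbb{P}(u_2)\|_{Z^{s,-\frac12}}\le C\Big(\|u_1\|_{Z^{s-1,\frac12}}\|u_2\|_{Z^{s-1,\frac13}}+\|u_1\|_{Z^{s-1,\frac13}}\|u_2\|_{Z^{s-1,\frac12}}\Big).$$
   Context: Functions are defined on $\mathbb{T}^2=[0,2\pi]_x\times[0,2\pi]_t$ (periodic in both variables), and $\widehat u(n,\tau)$, $(n,\tau)\in\mathbb{Z}^2$, are the space-time Fourier coefficients; products are given on the Fourier side by convolution. Let $P(n)=n^3-2n^2+8n$ and $\langle y\rangle=1+|y|$. Define $$\|u\|_{X^{s,b}}=\Big(\sum_{n}\langle n\rangle^{2s}\sum_{\tau}\langle\tau-P(n)\rangle^{2b}|\widehat u(n,\tau)|^2\Big)^{1/2},\qquad \|u\|_{Y^{s,b}}=\Big[\sum_{n}\langle n\rangle^{2s}\Big(\sum_{\tau}\langle\tau-P(n)\rangle^{b}|\widehat u(n,\tau)|\Big)^2\Big]^{1/2},$$ and $Z^{s,b}=X^{s,b}\cap Y^{s,b-\frac12}$ with norm $\|u\|_{Z^{s,b}}=\|u\|_{X^{s,b}}+\|u\|_{Y^{s,b-\frac12}}$. The operator $\mathbb{P}$ is the orthogonal projection onto the functions of zero mean in $x$, i.e. it removes the $n=0$ mode in $x$ and leaves the other modes unchanged. *)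

theory Defs
  imports "HOL-Analysis.Analysis"
begin

text \<open>
  A function (more precisely, a periodic distribution) on
  \<open>[0,2\<pi>]\<^sub>x \<times> [0,2\<pi>]\<^sub>t\<close> is represented by its
  family of space-time Fourier coefficients, \<open>u n \<tau>\<close> being the coefficient at
  frequency \<open>(n, \<tau>)\<close>. Genuine functions would not be enough: for \<open>s < 1\<close> the space
  \<open>Z\<^bsup>s-1,1/2\<^esup>\<close> contains distributions that are not functions. A family
  for which one of the norms below is finite grows at most polynomially, hence is the coefficient
  family of exactly one distribution.
\<close>

type_synonym fourier_coeffs = "int \<Rightarrow> int \<Rightarrow> complex"

definition disp :: "int \<Rightarrow> int" where
  "disp n = n ^ 3 - 2 * n ^ 2 + 8 * n"

definition bracket :: "int \<Rightarrow> real" where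
  "bracket y = 1 + \<bar>real_of_int y\<bar>"

text \<open>The norms take values in \<open>[0, \<infinity>]\<close>, where the defining sums always converge.\<close>

definition ennsqrt :: "ennreal \<Rightarrow> ennreal" where
  "ennsqrt x = (if x = top then top else ennreal (sqrt (enn2real x)))"

definition X_norm :: "real \<Rightarrow> real \<Rightarrow> fourier_coeffs \<Rightarrow> ennreal" where
  "X_norm s b u = ennsqrt
     (\<Sum>\<^sub>\<infinity>n. ennreal (bracket n powr (2 * s)) *
        (\<Sum>\<^sub>\<infinity>\<tau>. ennreal (bracket (\<tau> - disp n) powr (2 * b) * (cmod (u n \<tau>))\<^sup>2)))"

definition Y_norm :: "real \<Rightarrow> real \<Rightarrow> fourier_coeffs \<Rightarrow> ennreal" where
  "Y_norm s b u = ennsqrt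
     (\<Sum>\<^sub>\<infinity>n. ennreal (bracket n powr (2 * s)) *
        (\<Sum>\<^sub>\<infinity>\<tau>. ennreal (bracket (\<tau> - disp n) powr b * cmod (u n \<tau>)))\<^sup>2)"

definition Z_norm :: "real \<Rightarrow> real \<Rightarrow> fourier_coeffs \<Rightarrow> ennreal" where
  "Z_norm s b u = X_norm s b u + Y_norm s (b - 1/2) u"

definition Z_space :: "real \<Rightarrow> real \<Rightarrow> fourier_coeffs set" where
  "Z_space s b = {u. Z_norm s b u < top}"

definition proj_mean_zero :: "fourier_coeffs \<Rightarrow> fourier_coeffs" where
  "proj_mean_zero u = (\<lambda>n \<tau>. if n = 0 then 0 else u n \<tau>)"

text \<open>
  The product of two functions, given on the Fourier side by convolution. The value
  \<open>product u v\<close> is meaningful only if all the convolution sums converge absolutely, as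
  expressed by \<open>product_defined\<close> (for complex series, \<open>summable_on\<close> is
  absolute summability); otherwise \<open>infsum\<close> returns a default value.
\<close>

definition product_defined :: "fourier_coeffs \<Rightarrow> fourier_coeffs \<Rightarrow> bool" where
  "product_defined u v \<longleftrightarrow>
     (\<forall>n \<tau>. (\<lambda>(m, \<sigma>). u m \<sigma> * v (n - m) (\<tau> - \<sigma>)) summable_on UNIV)"

definition product :: "fourier_coeffs \<Rightarrow> fourier_coeffs \<Rightarrow> fourier_coeffs" where
  "product u v = (\<lambda>n \<tau>. \<Sum>\<^sub>\<infinity>(m, \<sigma>). u m \<sigma> * v (n - m) (\<tau> - \<sigma>))"

end

theory Submission
  imports Defs
begin

text \<open>
  With \<open>n = m + k\<close> one has \<open>P(n) - P(m) - P(k) = m k (3n - 4)\<close>, which for nonzero \<open>m, k\<close> is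
  comparable to \<open>\<langle>n\<rangle>\<langle>m\<rangle>\<langle>k\<rangle>\<close>. Hence the largest of the three modulations \<open>\<tau> - P\<close>
  dominates this product, and half a power of it pays for the weights \<open>\<langle>n\<rangle>\<^sup>s\<langle>m\<rangle>\<^bsup>1-s\<^esup>\<langle>k\<rangle>\<^bsup>1-s\<^esup>\<close>.
  Since every term on the right carries one factor with exponent \<open>1/2\<close>, the \<open>L\<^sup>4\<close> Strichartz
  estimate is not needed: what remains follows from the Cauchy-Schwarz inequality with the squared kernel
  \<open>\<langle>\<sigma>\<^sub>1\<rangle>\<^bsup>-11/12\<^esup>\<langle>\<sigma>\<^sub>2\<rangle>\<^bsup>-2/3\<^esup>\<close>. Its sum in \<open>\<tau>\<close> decays like \<open>\<langle>q\<rangle>\<^bsup>-13/24\<^esup>\<close>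
  with \<open>q\<close> a quadratic polynomial in the remaining frequency, and \<open>13/24 > 1/2\<close> makes this
  summable uniformly in the coefficients. In the \<open>Y\<close> part, when the output modulation dominates, one
  has \<open>\<langle>\<sigma>\<rangle>\<^bsup>-1\<^esup>(\<langle>n\<rangle>\<langle>m\<rangle>\<langle>k\<rangle>)\<^bsup>1/2\<^esup> \<lesssim> \<langle>n\<rangle>\<^bsup>-2/3\<^esup>\<langle>\<sigma>\<^sub>2\<rangle>\<^bsup>-1/6\<^esup>\<close>,
  and \<open>\<langle>n\<rangle>\<^bsup>-2/3\<^esup>\<close> is square summable, so the \<open>Y\<close> norms of the factors suffice.
\<close>

section \<open>Sums over countable sets\<close>

abbreviation esum :: "('a \<Rightarrow> ennreal) \<Rightarrow> ennreal"  (binder "\<Sum>\<^sup>+" 10)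
  where "esum \<equiv> nn_integral (count_space UNIV)"

text \<open>Both sides are suprema of finite partial sums. Countability supplies the increasing
  finite sets \<open>A k\<close> that exhaust the type, so monotone convergence applies. The norms
  can then be handled with Tonelli and Cauchy-Schwarz for the counting measure.\<close>

lemma infsum_eq_esum:
  fixes f :: "'a::countable \<Rightarrow> ennreal"
  shows "(\<Sum>\<^sub>\<infinity>x. f x) = (\<Sum>\<^sup>+x. f x)"
proof (rule antisym)
  have "sum f F \<le> esum f" if "finite F" for F
  proof -
    have "sum f F = (\<Sum>\<^sup>+x. f x * indicator F x)"
      using that by (subst nn_integral_count_space'[of F]) auto
    also have "\<dots> \<le> esum f"
      by (intro nn_integral_mono) (auto simp: indicator_def)
    finally show ?thesis .
  qed
  then show "infsum f UNIV \<le> esum f"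
    by (auto simp: nonneg_infsum_complete intro!: SUP_least)
next
  define A where "A k = {x::'a. to_nat x < k}" for k
  have fin: "finite (A k)" for k
  proof -
    have "inj_on to_nat (A k)" "to_nat ` A k \<subseteq> {..<k}" by (auto simp: A_def)
    then show ?thesis by (meson finite_lessThan inj_on_finite)
  qed
  have "esum f = (\<Sum>\<^sup>+x. SUP k. f x * indicator (A k) x)"
  proof (intro nn_integral_cong antisym)
    fix x
    have "f x = f x * indicator (A (Suc (to_nat x))) x" by (simp add: A_def)
    also have "\<dots> \<le> (SUP k. f x * indicator (A k) x)" by (rule SUP_upper) simp
    finally show "f x \<le> (SUP k. f x * indicator (A k) x)" .
  qed (auto intro!: SUP_least simp: indicator_def)
  also have "\<dots> = (SUP k. \<Sum>\<^sup>+x. f x * indicator (A k) x)"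
    by (intro nn_integral_monotone_convergence_SUP)
       (auto simp: incseq_def le_fun_def indicator_def A_def)
  also have "\<dots> = (SUP k. sum f (A k))"
  proof (intro SUP_cong refl)
    fix k
    show "(\<Sum>\<^sup>+x. f x * indicator (A k) x) = sum f (A k)"
      using fin[of k] by (subst nn_integral_count_space'[of "A k"]) (auto simp: indicator_def)
  qed
  also have "\<dots> \<le> infsum f UNIV"
    using fin by (auto intro!: SUP_least SUP_upper simp: nonneg_infsum_complete)
  finally show "esum f \<le> infsum f UNIV" .
qed

lemma esum_Cauchy_Schwarz:
  "(\<Sum>\<^sup>+x. f x * g x)\<^sup>2 \<le> (\<Sum>\<^sup>+x. (f x)\<^sup>2) * (\<Sum>\<^sup>+x. (g x)\<^sup>2)"
  by (rule Cauchy_Schwarz_nn_integral) simp_all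

lemma esum_pair: "(\<Sum>\<^sup>+x. \<Sum>\<^sup>+y. f (x, y)) = esum f"
  by (rule nn_integral_fst_count_space)

lemma esum_swap: "(\<Sum>\<^sup>+x. \<Sum>\<^sup>+y. f x y) = (\<Sum>\<^sup>+y. \<Sum>\<^sup>+x. f x y)"
  using nn_integral_fst_count_space[of "\<lambda>(x, y). f x y"]
    nn_integral_snd_count_space[of "\<lambda>(x, y). f x y"] by simp

lemma esum_shift: "(\<Sum>\<^sup>+x. f (x - c)) = esum f" for c :: "'a::group_add"
  by (rule nn_integral_bij_count_space) (rule bij_betw_byWitness[where f' = "\<lambda>x. x + c"], auto)

lemma esum_reflect: "(\<Sum>\<^sup>+x. f (c - x)) = esum f" for c :: "'a::ab_group_add"
  by (rule nn_integral_bij_count_space) (rule bij_betw_byWitness[where f' = "\<lambda>x. c - x"], auto)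

text \<open>Cauchy-Schwarz at fixed output \<open>z\<close> sets the kernel against the product of
  the factors. The kernel sum is uniform in \<open>z\<close>, and Tonelli with translation
  invariance separates \<open>f\<close> from \<open>g\<close>.\<close>

lemma bilinear_L2_bound:
  fixes f g :: "'a::ab_group_add \<Rightarrow> ennreal"
  assumes "\<And>z. (\<Sum>\<^sup>+x. (k x z)\<^sup>2) \<le> C"
  shows "(\<Sum>\<^sup>+z. (\<Sum>\<^sup>+x. k x z * (f x * g (z - x)))\<^sup>2) \<le> C * (\<Sum>\<^sup>+x. (f x)\<^sup>2) * (\<Sum>\<^sup>+x. (g x)\<^sup>2)"
proof -
  have "(\<Sum>\<^sup>+z. (\<Sum>\<^sup>+x. k x z * (f x * g (z - x)))\<^sup>2) \<le> (\<Sum>\<^sup>+z. C * (\<Sum>\<^sup>+x. (f x)\<^sup>2 * (g (z - x))\<^sup>2))"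
    by (intro nn_integral_mono order_trans[OF esum_Cauchy_Schwarz] mult_mono)
       (auto simp: assms power_mult_distrib)
  also have "\<dots> = C * (\<Sum>\<^sup>+x. (f x)\<^sup>2 * (\<Sum>\<^sup>+z. (g (z - x))\<^sup>2))"
    by (simp add: nn_integral_cmult esum_swap[of "\<lambda>z x. (f x)\<^sup>2 * (g (z - x))\<^sup>2"])
  also have "\<dots> = C * (\<Sum>\<^sup>+x. (f x)\<^sup>2) * (\<Sum>\<^sup>+x. (g x)\<^sup>2)"
    by (simp add: esum_shift[of "\<lambda>x. (g x)\<^sup>2"] nn_integral_multc mult.assoc)
  finally show ?thesis .
qed

text \<open>Here Cauchy-Schwarz keeps the kernel next to \<open>f\<close>, so the kernel is summed
  over the output \<open>z\<close> at fixed \<open>x\<close>. Asking for the bound only on the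
  support of \<open>f\<close> leaves room for exceptional frequencies.\<close>

lemma bilinear_L2_bound_dual:
  fixes f g :: "'a::ab_group_add \<Rightarrow> ennreal"
  assumes "\<And>x. f x \<noteq> 0 \<Longrightarrow> (\<Sum>\<^sup>+z. (k x z)\<^sup>2) \<le> C"
  shows "(\<Sum>\<^sup>+z. (\<Sum>\<^sup>+x. k x z * (f x * g (z - x)))\<^sup>2) \<le> C * (\<Sum>\<^sup>+x. (f x)\<^sup>2) * (\<Sum>\<^sup>+x. (g x)\<^sup>2)"
proof -
  let ?G = "\<Sum>\<^sup>+x. (g x)\<^sup>2"
  have "(\<Sum>\<^sup>+z. (\<Sum>\<^sup>+x. k x z * (f x * g (z - x)))\<^sup>2) \<le> (\<Sum>\<^sup>+z. (\<Sum>\<^sup>+x. (k x z * f x)\<^sup>2) * ?G)"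
  proof (intro nn_integral_mono)
    fix z
    show "(\<Sum>\<^sup>+x. k x z * (f x * g (z - x)))\<^sup>2 \<le> (\<Sum>\<^sup>+x. (k x z * f x)\<^sup>2) * ?G"
      using esum_Cauchy_Schwarz[of "\<lambda>x. k x z * f x" "\<lambda>x. g (z - x)"]
      by (simp add: esum_reflect[of "\<lambda>x. (g x)\<^sup>2"] mult.assoc)
  qed
  also have "\<dots> = (\<Sum>\<^sup>+x. (f x)\<^sup>2 * (\<Sum>\<^sup>+z. (k x z)\<^sup>2)) * ?G"
    by (simp add: nn_integral_multc esum_swap[of "\<lambda>z x. (k x z * f x)\<^sup>2"],
        simp add: power_mult_distrib nn_integral_multc mult.commute[of "(f _)\<^sup>2"])
  also have "\<dots> \<le> (\<Sum>\<^sup>+x. (f x)\<^sup>2 * C) * ?G"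
  proof (intro mult_right_mono nn_integral_mono)
    fix x show "(f x)\<^sup>2 * (\<Sum>\<^sup>+z. (k x z)\<^sup>2) \<le> (f x)\<^sup>2 * C"
      using assms[of x] by (cases "f x = 0") (auto intro: mult_left_mono)
  qed simp
  also have "\<dots> = C * (\<Sum>\<^sup>+x. (f x)\<^sup>2) * ?G"
    by (subst nn_integral_multc) (simp_all add: mult.commute)
  finally show ?thesis .
qed

section \<open>Weights and one-variable sums\<close>

definition wt :: "int \<Rightarrow> real \<Rightarrow> ennreal" where
  "wt y p = ennreal (bracket y powr p)"

lemma bracket_ge_1: "1 \<le> bracket y" by (simp add: bracket_def)

lemma bracket_pos [simp]: "0 < bracket y" using bracket_ge_1[of y] by linarith

lemma bracket_neq_0 [simp]: "bracket y \<noteq> 0"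
  using bracket_ge_1[of y] by linarith

lemma bracket_minus_commute: "bracket (x - y) = bracket (y - x)"
  by (simp add: bracket_def abs_minus_commute)

lemma wt_minus_commute: "wt (x - y) p = wt (y - x) p"
  by (simp add: wt_def bracket_minus_commute)

lemma wt_add: "wt y (p + q) = wt y p * wt y q"
  by (simp add: wt_def powr_add ennreal_mult)

lemma wt_power2: "(wt y p)\<^sup>2 = wt y (2 * p)"
  by (simp only: power2_eq_square wt_add[symmetric] mult_2)

lemma wt_zero [simp]: "wt y 0 = 1"
  using bracket_pos[of y] by (simp add: wt_def del: bracket_pos)

lemma wt_mono: "p \<le> q \<Longrightarrow> wt y p \<le> wt y q"
  using bracket_ge_1[of y] by (auto simp: wt_def intro!: ennreal_leI powr_mono)

lemma wt_neq_0 [simp]: "wt y p \<noteq> 0"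
  using bracket_pos[of y] by (simp add: wt_def del: bracket_pos)

lemma esum_wt_finite:
  assumes "p > 1"
  shows "(\<Sum>\<^sup>+n. wt n (- p)) < top"
proof -
  define g where "g k = ennreal (real (Suc k) powr (- p))" for k
  \<comment> \<open>Every integer is \<open>int k\<close> or \<open>- int k\<close>, so two copies
    of the series over the naturals dominate; counting 0 twice does no harm.\<close>
  have "(\<Sum>\<^sup>+n. wt n (- p)) \<le> (\<Sum>\<^sup>+n::int. \<Sum>\<^sup>+k. g k * indicator {int k} n + g k * indicator {- int k} n)"
  proof (intro nn_integral_mono)
    fix n :: int
    have "wt n (- p) = g (nat \<bar>n\<bar>)" by (simp add: wt_def g_def bracket_def)
    also have "\<dots> \<le> (\<lambda>k. g k * indicator {int k} n + g k * indicator {- int k} n) (nat \<bar>n\<bar>)"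
      by (cases "n \<ge> 0") auto
    also have "\<dots> \<le> (\<Sum>\<^sup>+k. g k * indicator {int k} n + g k * indicator {- int k} n)"
      by (rule nn_integral_ge_point) simp
    finally show "wt n (- p) \<le> (\<Sum>\<^sup>+k. g k * indicator {int k} n + g k * indicator {- int k} n)" .
  qed
  also have "\<dots> = (\<Sum>\<^sup>+k. g k + g k)"
    by (subst esum_swap) (simp add: nn_integral_add nn_integral_cmult)
  also have "\<dots> = (\<Sum>k. ennreal (real (Suc k) powr (- p) + real (Suc k) powr (- p)))"
    by (simp add: nn_integral_count_space_nat g_def flip: ennreal_plus del: of_nat_Suc)
  also have "\<dots> < top"
  proof -
    have "summable (\<lambda>k. real (Suc k) powr (- p))"
      using assms by (subst summable_Suc_iff) (simp add: summable_real_powr_iff)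
    then have "summable (\<lambda>k. real (Suc k) powr (- p) + real (Suc k) powr (- p))"
      by (intro summable_add)
    then show ?thesis
      by (subst suminf_ennreal2) (auto intro: ennreal_less_top)
  qed
  finally show ?thesis .
qed

text \<open>The centres will be real roots of quadratic polynomials. Rounding \<open>c\<close> down
  moves it by less than 1, which at most doubles the bracket, and an integer shift leaves the sum
  unchanged.\<close>

lemma esum_shifted_bracket_bound:
  assumes "p > 1"
  shows "\<exists>C<top. \<forall>c::real. (\<Sum>\<^sup>+n::int. ennreal ((1 + \<bar>real_of_int n - c\<bar>) powr (- p))) \<le> C"
proof (intro exI[of _ "ennreal (2 powr p) * (\<Sum>\<^sup>+n. wt n (- p))"] conjI allI)
  show "ennreal (2 powr p) * (\<Sum>\<^sup>+n. wt n (- p)) < top"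
    using esum_wt_finite[OF assms] by (simp add: ennreal_mult_less_top)
  fix c :: real
  have "(\<Sum>\<^sup>+n. ennreal ((1 + \<bar>real_of_int n - c\<bar>) powr (- p)))
    \<le> (\<Sum>\<^sup>+n. ennreal (2 powr p) * wt (n - \<lfloor>c\<rfloor>) (- p))"
  proof (intro nn_integral_mono)
    fix n :: int
    have "bracket (n - \<lfloor>c\<rfloor>) / 2 \<le> 1 + \<bar>real_of_int n - c\<bar>"
      using of_int_floor_le[of c] real_of_int_floor_add_one_gt[of c]
      unfolding bracket_def of_int_diff by argo
    then have "(1 + \<bar>real_of_int n - c\<bar>) powr (- p) \<le> (bracket (n - \<lfloor>c\<rfloor>) / 2) powr (- p)"
      using assms by (intro powr_mono2') auto
    also have "\<dots> = 2 powr p * bracket (n - \<lfloor>c\<rfloor>) powr (- p)"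
      by (simp add: powr_divide less_imp_le powr_minus field_simps)
    finally show "ennreal ((1 + \<bar>real_of_int n - c\<bar>) powr (- p)) \<le> ennreal (2 powr p) * wt (n - \<lfloor>c\<rfloor>) (- p)"
      by (simp add: wt_def ennreal_mult[symmetric] ennreal_leI)
  qed
  also have "\<dots> = ennreal (2 powr p) * (\<Sum>\<^sup>+n. wt n (- p))"
    by (simp add: nn_integral_cmult esum_shift[of "\<lambda>n. wt n (- p)"])
  finally show "(\<Sum>\<^sup>+n. ennreal ((1 + \<bar>real_of_int n - c\<bar>) powr (- p)))
    \<le> ennreal (2 powr p) * (\<Sum>\<^sup>+n. wt n (- p))" .
qed

section \<open>Sums over the values of a quadratic polynomial\<close>

lemma quadratic_lower_bound:
  fixes a b c :: real
  assumes "\<bar>a\<bar> \<ge> 1"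
  obtains u v where "\<And>y. \<bar>y - u\<bar> * \<bar>y - v\<bar> \<le> \<bar>a * y\<^sup>2 + b * y + c\<bar>"
proof -
  define h d where "h = - b / (2 * a)" and "d = c / a - h\<^sup>2"
  have a: "a \<noteq> 0" using assms by auto
  have eq: "a * y\<^sup>2 + b * y + c = a * ((y - h)\<^sup>2 + d)" for y
    using a unfolding h_def d_def by (simp add: field_simps power2_eq_square)
  have ge: "\<bar>(y - h)\<^sup>2 + d\<bar> \<le> \<bar>a * y\<^sup>2 + b * y + c\<bar>" for y
    unfolding eq abs_mult using assms mult_right_mono[of 1 "\<bar>a\<bar>" "\<bar>(y - h)\<^sup>2 + d\<bar>"] by simp
  show thesis
  proof (cases "d \<ge> 0")
    case True
    have "\<bar>y - h\<bar> * \<bar>y - h\<bar> \<le> \<bar>(y - h)\<^sup>2 + d\<bar>" for y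
      using True by (simp add: power2_eq_square flip: abs_mult)
    then show thesis using that[of h h] ge order_trans by blast
  next
    case False
    have "(y - (h + sqrt (- d))) * (y - (h - sqrt (- d))) = (y - h)\<^sup>2 + d" for y
      using False by (simp add: algebra_simps power2_eq_square)
    then have "\<bar>y - (h + sqrt (- d))\<bar> * \<bar>y - (h - sqrt (- d))\<bar> = \<bar>(y - h)\<^sup>2 + d\<bar>" for y
      by (metis abs_mult)
    then show thesis using that ge by metis
  qed
qed

text \<open>With \<open>m\<close> the smaller of the two,
  \<open>(1 + m)\<^sup>2 \<le> 2 * (1 + m\<^sup>2)\<close>, so decay of order \<open>r\<close> in
  the product is decay of order \<open>2 * r\<close> in a single factor. Hence the threshold 1/2 for
  summability over a quadratic.\<close>

lemma product_bracket_bound: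
  fixes x y r :: real
  assumes "r \<ge> 0" "x \<ge> 0" "y \<ge> 0"
  shows "(1 + x * y) powr (- r) \<le> 2 powr r * ((1 + x) powr (- (2 * r)) + (1 + y) powr (- (2 * r)))"
proof -
  define m where "m = min x y"
  have m: "m \<ge> 0" "m * m \<le> x * y" using assms by (auto simp: m_def intro: mult_mono)
  have "(1 + m)\<^sup>2 / 2 \<le> 1 + x * y"
    using m(2) sum_squares_bound[of 1 m] by (simp add: power2_eq_square algebra_simps)
  then have "(1 + x * y) powr (- r) \<le> ((1 + m)\<^sup>2 / 2) powr (- r)"
    using assms m by (intro powr_mono2') auto
  also have "\<dots> = 2 powr r * (1 + m) powr (- (2 * r))"
    using m by (simp add: powr_divide powr_minus field_simps powr_powr flip: powr_numeral)
  also have "\<dots> \<le> 2 powr r * ((1 + x) powr (- (2 * r)) + (1 + y) powr (- (2 * r)))"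
    by (auto simp: m_def min_def)
  finally show ?thesis .
qed

text \<open>The coefficients only determine the two centres \<open>u\<close> and \<open>v\<close>,
  and the sum of shifted brackets is bounded uniformly in its centre; so \<open>C\<close> is the
  same for all quadratics.\<close>

lemma esum_quadratic_bound:
  assumes "r > 1/2"
  shows "\<exists>C<top. \<forall>a b c. a \<noteq> 0 \<longrightarrow> (\<Sum>\<^sup>+n. wt (a * n\<^sup>2 + b * n + c) (- r)) \<le> C"
proof -
  obtain C where C: "C < top"
    "\<And>c. (\<Sum>\<^sup>+n::int. ennreal ((1 + \<bar>real_of_int n - c\<bar>) powr (- (2 * r)))) \<le> C"
    using esum_shifted_bracket_bound[of "2 * r"] assms by auto
  show ?thesis
  proof (intro exI[of _ "ennreal (2 powr r) * (C + C)"] conjI allI impI)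
    show "ennreal (2 powr r) * (C + C) < top" using C by (simp add: ennreal_mult_less_top)
    fix a b c :: int assume "a \<noteq> 0"
    then have "\<bar>real_of_int a\<bar> \<ge> 1" by linarith
    then obtain u v where uv: "\<And>y. \<bar>y - u\<bar> * \<bar>y - v\<bar> \<le>
        \<bar>real_of_int a * y\<^sup>2 + real_of_int b * y + real_of_int c\<bar>"
      using quadratic_lower_bound by blast
    let ?e = "\<lambda>w n. ennreal ((1 + \<bar>real_of_int n - w\<bar>) powr (- (2 * r)))"
    have "(\<Sum>\<^sup>+n. wt (a * n\<^sup>2 + b * n + c) (- r)) \<le> (\<Sum>\<^sup>+n. ennreal (2 powr r) * (?e u n + ?e v n))"
    proof (intro nn_integral_mono)
      fix n
      have "bracket (a * n\<^sup>2 + b * n + c) powr (- r) \<le> (1 + \<bar>real_of_int n - u\<bar> * \<bar>real_of_int n - v\<bar>) powr (- r)"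
        using uv[of "real_of_int n"] assms
        by (intro powr_mono2') (auto simp: bracket_def intro!: add_pos_nonneg)
      also have "\<dots> \<le> 2 powr r * ((1 + \<bar>real_of_int n - u\<bar>) powr (- (2 * r)) + (1 + \<bar>real_of_int n - v\<bar>) powr (- (2 * r)))"
        using assms by (intro product_bracket_bound) auto
      finally show "wt (a * n\<^sup>2 + b * n + c) (- r) \<le> ennreal (2 powr r) * (?e u n + ?e v n)"
        by (simp add: wt_def ennreal_leI flip: ennreal_plus ennreal_mult)
    qed
    also have "\<dots> = ennreal (2 powr r) * ((\<Sum>\<^sup>+n. ?e u n) + (\<Sum>\<^sup>+n. ?e v n))"
      by (simp add: nn_integral_cmult nn_integral_add)
    also have "\<dots> \<le> ennreal (2 powr r) * (C + C)"
      by (intro mult_left_mono add_mono C) simp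
    finally show "(\<Sum>\<^sup>+n. wt (a * n\<^sup>2 + b * n + c) (- r)) \<le> ennreal (2 powr r) * (C + C)" .
  qed
qed

section \<open>Convolution of two bracket powers\<close>

lemma bracket_convolution_pointwise:
  assumes "0 \<le> r" "r \<le> p" "r \<le> q"
  shows "bracket x powr (- p) * bracket y powr (- q) \<le>
    2 powr r * bracket (x + y) powr (- r) *
      (bracket x powr (- (p + q - r)) + bracket y powr (- (p + q - r)))"
proof -
  define X Y where "X = bracket x" and "Y = bracket y"
  have XY: "X \<ge> 1" "Y \<ge> 1" by (simp_all add: X_def Y_def bracket_ge_1)
  define t where "t = p + q - r"
  \<comment> \<open>\<open>U\<close> is the larger of the two brackets, hence at least half of
    \<open>bracket (x + y)\<close>. It gives up \<open>r\<close> of its powers for the decay in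
    \<open>x + y\<close>; its remaining powers pass to the smaller bracket \<open>V\<close>, giving
    the total exponent \<open>t\<close>.\<close>
  have main: "U powr (- p') * V powr (- q') \<le> 2 powr r * bracket (x + y) powr (- r) * V powr (- t)"
    if "U \<ge> V" "V \<ge> 1" "bracket (x + y) \<le> 2 * U" "p' \<ge> r" "p' + q' = p + q" for U V p' q'
  proof -
    have "U powr (- p') = U powr (- r) * U powr (- (p' - r))"
      using that by (simp flip: powr_add)
    also have "\<dots> \<le> (bracket (x + y) / 2) powr (- r) * V powr (- (p' - r))"
      using that assms by (intro mult_mono powr_mono2') auto
    also have "(bracket (x + y) / 2) powr (- r) = 2 powr r * bracket (x + y) powr (- r)"
      by (simp add: powr_divide less_imp_le powr_minus field_simps)
    finally have "U powr (- p') * V powr (- q') \<le>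
        2 powr r * bracket (x + y) powr (- r) * V powr (- (p' - r)) * V powr (- q')"
      by (intro mult_right_mono) auto
    also have "\<dots> = 2 powr r * bracket (x + y) powr (- r) * V powr (- t)"
      using that(5) by (simp add: t_def mult.assoc algebra_simps flip: powr_add)
    finally show ?thesis .
  qed
  have tri: "bracket (x + y) \<le> X + Y" by (auto simp: X_def Y_def bracket_def)
  have "X powr (- p) * Y powr (- q) \<le> 2 powr r * bracket (x + y) powr (- r) * (X powr (- t) + Y powr (- t))"
  proof (cases "X \<ge> Y")
    case True
    then have "X powr (- p) * Y powr (- q) \<le> 2 powr r * bracket (x + y) powr (- r) * Y powr (- t)"
      using XY tri assms by (intro main) auto
    also have "\<dots> \<le> 2 powr r * bracket (x + y) powr (- r) * (X powr (- t) + Y powr (- t))"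
      by (intro mult_left_mono) auto
    finally show ?thesis .
  next
    case False
    then have "Y powr (- q) * X powr (- p) \<le> 2 powr r * bracket (x + y) powr (- r) * X powr (- t)"
      using XY tri assms by (intro main) auto
    also have "\<dots> \<le> 2 powr r * bracket (x + y) powr (- r) * (X powr (- t) + Y powr (- t))"
      by (intro mult_left_mono) auto
    finally show ?thesis by (simp add: mult.commute)
  qed
  then show ?thesis by (simp add: X_def Y_def t_def)
qed

section \<open>The resonance function and kernel bounds\<close>

lemma esum_bracket_convolution:
  assumes "0 \<le> r" "r \<le> p" "r \<le> q" "p + q - r > 1"
  shows "\<exists>C<top. \<forall>k l. (\<Sum>\<^sup>+t. wt (t - k) (- p) * wt (l - t) (- q)) \<le> C * wt (l - k) (- r)"
proof -
  define S where "S = (\<Sum>\<^sup>+n. wt n (- (p + q - r)))"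
  have S: "S < top" unfolding S_def by (rule esum_wt_finite[OF assms(4)])
  show ?thesis
  proof (intro exI[of _ "ennreal (2 powr r) * (S + S)"] conjI allI)
    show "ennreal (2 powr r) * (S + S) < top" using S by (simp add: ennreal_mult_less_top)
    fix k l
    have "(\<Sum>\<^sup>+t. wt (t - k) (- p) * wt (l - t) (- q)) \<le>
        (\<Sum>\<^sup>+t. ennreal (2 powr r) * wt (l - k) (- r) * (wt (t - k) (- (p + q - r)) + wt (l - t) (- (p + q - r))))"
    proof (intro nn_integral_mono)
      fix t
      show "wt (t - k) (- p) * wt (l - t) (- q) \<le>
        ennreal (2 powr r) * wt (l - k) (- r) * (wt (t - k) (- (p + q - r)) + wt (l - t) (- (p + q - r)))"
        using bracket_convolution_pointwise[OF assms(1-3), of "t - k" "l - t"]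
        by (simp add: wt_def ennreal_leI flip: ennreal_plus ennreal_mult)
    qed
    also have "\<dots> = ennreal (2 powr r) * wt (l - k) (- r) * (S + S)"
      unfolding S_def
      by (simp add: nn_integral_cmult nn_integral_add esum_shift[of "\<lambda>t. wt t _"] esum_reflect[of "\<lambda>t. wt t _"])
    finally show "(\<Sum>\<^sup>+t. wt (t - k) (- p) * wt (l - t) (- q)) \<le> ennreal (2 powr r) * (S + S) * wt (l - k) (- r)"
      by (simp add: mult_ac)
  qed
qed

definition modulation :: "int \<times> int \<Rightarrow> int" where
  "modulation x = snd x - disp (fst x)"

text \<open>The cubic part of \<open>disp\<close> produces \<open>3 * n\<close>, the quadratic part
  \<open>- 4\<close>, and the linear part cancels. The last factor has no integer zero because 3
  does not divide 4.\<close>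

lemma disp_resonance: "disp n - disp m - disp (n - m) = m * (n - m) * (3 * n - 4)"
  by (simp add: disp_def algebra_simps power2_eq_square power3_eq_cube)

text \<open>The time frequency is summed first, by the bracket convolution bound. What is left
  depends on a quadratic in the other frequency, with leading coefficient
  \<open>- (3 * n - 4)\<close> when the output is fixed and \<open>- 3 * m\<close> when an input is
  fixed. Only the latter can vanish, at input frequency 0.\<close>

lemma kernel_bounds:
  shows kernel_bound: "\<exists>C<top. \<forall>z. (\<Sum>\<^sup>+x. (wt (modulation x) (-11/24) * wt (modulation (z - x)) (-1/3))\<^sup>2) \<le> C"
    and kernel_bound_dual: "\<exists>C<top. \<forall>x. fst x \<noteq> 0 \<longrightarrow>
      (\<Sum>\<^sup>+z. (wt (modulation z) (-11/24) * wt (modulation (z - x)) (-1/3))\<^sup>2) \<le> C"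
proof -
  \<comment> \<open>The exponents 11/12 and 2/3 are twice 11/24 and 1/3. The choice 13/24 lies below
    both, satisfies 11/12 + 2/3 - 13/24 = 25/24 > 1, and exceeds 1/2 as the quadratic sum
    requires.\<close>
  obtain C1 where C1: "C1 < top"
    "\<And>k l. (\<Sum>\<^sup>+t. wt (t - k) (- (11/12)) * wt (l - t) (- (2/3))) \<le> C1 * wt (l - k) (- (13/24))"
    using esum_bracket_convolution[of "13/24" "11/12" "2/3"] by auto
  obtain C2 where C2: "C2 < top"
    "\<And>a b c. a \<noteq> 0 \<Longrightarrow> (\<Sum>\<^sup>+n. wt (a * n\<^sup>2 + b * n + c) (- (13/24))) \<le> C2"
    using esum_quadratic_bound[of "13/24"] by auto
  have fin: "C1 * C2 < top" using C1 C2 by (simp add: ennreal_mult_less_top)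
  have bound: "(\<Sum>\<^sup>+n. \<Sum>\<^sup>+t. wt (t - k n) (- (11/12)) * wt (l n - t) (- (2/3))) \<le> C1 * C2"
    if "a \<noteq> 0" "\<And>n. l n - k n = a * n\<^sup>2 + b * n + c" for k l a b c
  proof -
    have "(\<Sum>\<^sup>+n. \<Sum>\<^sup>+t. wt (t - k n) (- (11/12)) * wt (l n - t) (- (2/3))) \<le>
        (\<Sum>\<^sup>+n. C1 * wt (a * n\<^sup>2 + b * n + c) (- (13/24)))"
      unfolding that(2)[symmetric] by (intro nn_integral_mono C1)
    also have "\<dots> \<le> C1 * C2"
      using C2(2)[OF that(1)] by (simp add: nn_integral_cmult mult_left_mono)
    finally show ?thesis .
  qed
  show "\<exists>C<top. \<forall>z. (\<Sum>\<^sup>+x. (wt (modulation x) (-11/24) * wt (modulation (z - x)) (-1/3))\<^sup>2) \<le> C"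
  proof (intro exI[of _ "C1 * C2"] conjI allI fin)
    fix z :: "int \<times> int"
    obtain n t where z: "z = (n, t)" by (cases z)
    have "(\<Sum>\<^sup>+x. (wt (modulation x) (-11/24) * wt (modulation (z - x)) (-1/3))\<^sup>2) =
        (\<Sum>\<^sup>+m. \<Sum>\<^sup>+u. wt (u - disp m) (- (11/12)) * wt (t - disp (n - m) - u) (- (2/3)))"
      unfolding esum_pair[symmetric] z
      by (simp add: modulation_def power_mult_distrib wt_power2 algebra_simps)
    also have "\<dots> \<le> C1 * C2"
    proof (rule bound[where a = "- (3 * n - 4)" and b = "n * (3 * n - 4)" and c = "t - disp n"])
      show "- (3 * n - 4) \<noteq> 0" by presburger
      show "t - disp (n - m) - disp m = - (3 * n - 4) * m\<^sup>2 + n * (3 * n - 4) * m + (t - disp n)" for m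
        using disp_resonance[of n m] by (simp add: algebra_simps power2_eq_square)
    qed
    finally show "(\<Sum>\<^sup>+x. (wt (modulation x) (-11/24) * wt (modulation (z - x)) (-1/3))\<^sup>2) \<le> C1 * C2" .
  qed
  show "\<exists>C<top. \<forall>x. fst x \<noteq> 0 \<longrightarrow>
      (\<Sum>\<^sup>+z. (wt (modulation z) (-11/24) * wt (modulation (z - x)) (-1/3))\<^sup>2) \<le> C"
  proof (intro exI[of _ "C1 * C2"] conjI allI impI fin)
    fix x :: "int \<times> int" assume x0: "fst x \<noteq> 0"
    obtain m u where x: "x = (m, u)" by (cases x)
    have "(\<Sum>\<^sup>+z. (wt (modulation z) (-11/24) * wt (modulation (z - x)) (-1/3))\<^sup>2) =
        (\<Sum>\<^sup>+n. \<Sum>\<^sup>+t. wt (t - disp n) (- (11/12)) * wt (u + disp (n - m) - t) (- (2/3)))"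
      unfolding esum_pair[symmetric] x
      by (simp add: modulation_def power_mult_distrib wt_power2
          wt_minus_commute[of "u + disp _"] algebra_simps)
    also have "\<dots> \<le> C1 * C2"
    proof (rule bound[where a = "- 3 * m" and b = "m * (4 + 3 * m)" and c = "u - disp m - 4 * m\<^sup>2"])
      show "- 3 * m \<noteq> 0" using x0 x by simp
      show "u + disp (n - m) - disp n = - 3 * m * n\<^sup>2 + m * (4 + 3 * m) * n + (u - disp m - 4 * m\<^sup>2)" for n
        using disp_resonance[of n m] by (simp add: algebra_simps power2_eq_square)
    qed
    finally show "(\<Sum>\<^sup>+z. (wt (modulation z) (-11/24) * wt (modulation (z - x)) (-1/3))\<^sup>2) \<le> C1 * C2" .
  qed
qed

section \<open>Pointwise consequences of the resonance\<close>

lemma bracket_mult_ge: "bracket (x + y) \<le> bracket x * bracket y"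
proof -
  have "bracket (x + y) \<le> 1 + \<bar>real_of_int x\<bar> + \<bar>real_of_int y\<bar>"
    by (auto simp: bracket_def)
  also have "\<dots> \<le> bracket x * bracket y" by (simp add: bracket_def algebra_simps)
  finally show ?thesis .
qed

text \<open>The time frequencies cancel in the signed sum of the three modulations, which therefore
  equals the resonance function. Each of its three factors controls its bracket up to a factor 2,
  hence the 8.\<close>

lemma resonance_lower_bound:
  assumes "m \<noteq> 0" "k \<noteq> 0"
  shows "bracket (m + k) * bracket m * bracket k
    \<le> 8 * (bracket (t + u - disp (m + k)) + bracket (t - disp m) + bracket (u - disp k))"
proof -
  let ?n = "m + k"
  have "bracket ?n \<le> 2 * \<bar>real_of_int (3 * ?n - 4)\<bar>"
  proof -
    \<comment> \<open>The constant 2 is attained at \<open>n = 1\<close>, where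
      \<open>3 * n - 4\<close> is -1; the sign of that factor changes between 1 and 2.\<close>
    have "1 + \<bar>n\<bar> \<le> 2 * \<bar>3 * n - 4\<bar>" for n :: int
      by (cases "n \<le> 1") auto
    from this[of ?n] show ?thesis unfolding bracket_def by linarith
  qed
  moreover have "bracket m \<le> 2 * \<bar>real_of_int m\<bar>" "bracket k \<le> 2 * \<bar>real_of_int k\<bar>"
    using assms unfolding bracket_def by linarith+
  ultimately have "bracket ?n * bracket m * bracket k
      \<le> (2 * \<bar>real_of_int (3 * ?n - 4)\<bar>) * (2 * \<bar>real_of_int m\<bar>) * (2 * \<bar>real_of_int k\<bar>)"
    by (intro mult_mono) (auto simp: less_imp_le)
  also have "\<dots> = 8 * \<bar>real_of_int (m * k * (3 * ?n - 4))\<bar>"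
    by (simp add: abs_mult mult_ac)
  also have "m * k * (3 * ?n - 4) = (t - disp m) + (u - disp k) - (t + u - disp ?n)"
    using disp_resonance[of ?n m] by simp
  also have "8 * \<bar>real_of_int \<dots>\<bar> \<le>
      8 * (bracket (t + u - disp ?n) + bracket (t - disp m) + bracket (u - disp k))"
    unfolding bracket_def of_int_add of_int_diff by argo
  finally show ?thesis .
qed

text \<open>The square root of the size of the resonance function: the gain that half a power of the
  dominant modulation can pay for.\<close>

definition res_weight :: "int \<Rightarrow> int \<Rightarrow> ennreal" where
  "res_weight m k = wt (m + k) (1/2) * wt m (1/2) * wt k (1/2)"

lemma res_weight_eq: "res_weight m k = ennreal (sqrt (bracket (m + k) * bracket m * bracket k))"
  unfolding res_weight_def wt_def
  by (simp add: powr_half_sqrt real_sqrt_mult less_imp_le flip: ennreal_mult)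

text \<open>Submultiplicativity of the bracket may be raised to the power \<open>s - 1/2\<close>
  because this exponent is nonnegative; the remaining half powers make up
  \<open>res_weight\<close>.\<close>

lemma wt_le_res_weight:
  assumes "s \<ge> 1/2"
  shows "wt (m + k) s \<le> res_weight m k * (wt m (s - 1) * wt k (s - 1))"
proof -
  have le: "wt (m + k) (s - 1/2) \<le> wt m (s - 1/2) * wt k (s - 1/2)"
    unfolding wt_def using assms powr_mono2[OF _ _ bracket_mult_ge, of "s - 1/2" m k]
    by (simp add: ennreal_leI less_imp_le powr_mult flip: ennreal_mult)
  have "wt (m + k) s = wt (m + k) (1/2) * wt (m + k) (s - 1/2)"
    by (simp flip: wt_add)
  also have "\<dots> \<le> wt (m + k) (1/2) * (wt m (s - 1/2) * wt k (s - 1/2))"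
    using le by (rule mult_left_mono) simp
  also have "wt m (s - 1/2) = wt m (1/2) * wt m (s - 1)" by (simp flip: wt_add)
  also have "wt k (s - 1/2) = wt k (1/2) * wt k (s - 1)" by (simp flip: wt_add)
  finally show ?thesis by (simp add: res_weight_def mult_ac)
qed
lemma res_weight_le:
  assumes "m \<noteq> 0" "k \<noteq> 0"
  shows "res_weight m k \<le> 3 * (wt (t + u - disp (m + k)) (1/2) + wt (t - disp m) (1/2) + wt (u - disp k) (1/2))"
proof -
  define a b c where "a = bracket (t + u - disp (m + k))" and "b = bracket (t - disp m)"
    and "c = bracket (u - disp k)"
  have p: "0 < a" "0 < b" "0 < c" by (simp_all add: a_def b_def c_def)
  have "sqrt (bracket (m + k) * bracket m * bracket k) \<le> sqrt (8 * (a + b + c))"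
    using resonance_lower_bound[OF assms] by (simp add: a_def b_def c_def)
  \<comment> \<open>8 is rounded up to a perfect square, and then the square root is split by
    subadditivity.\<close>
  also have "\<dots> \<le> sqrt (9 * (a + b + c))" using p by (intro real_sqrt_le_mono) argo
  also have "\<dots> = 3 * sqrt (a + b + c)" unfolding real_sqrt_mult by simp
  also have "\<dots> \<le> 3 * (sqrt a + sqrt b + sqrt c)"
    using p sqrt_add_le_add_sqrt[of "a + b" c] sqrt_add_le_add_sqrt[of a b] by simp
  finally have "res_weight m k \<le> ennreal (3 * (sqrt a + sqrt b + sqrt c))"
    unfolding res_weight_eq by (rule ennreal_leI)
  then show ?thesis
    using p unfolding wt_def a_def[symmetric] b_def[symmetric] c_def[symmetric]
    by (simp add: powr_half_sqrt ennreal_mult' less_imp_le)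
qed

text \<open>Here \<open>a\<close> stands for the output modulation, \<open>b\<close> and
  \<open>c\<close> for those of the factors, \<open>N\<close> for the output frequency bracket and
  \<open>R\<close> for the resonance size. If \<open>a\<close> is not the largest,
  \<open>sqrt R\<close> is paid for by \<open>b\<close> or \<open>c\<close>. If it is,
  \<open>a\<close> absorbs the root and still leaves decay in \<open>N\<close> and
  \<open>c\<close>.\<close>

lemma res_weight_le_Y_real:
  fixes a b c N R :: real
  assumes pos: "0 < a" "0 < b" "0 < c" "0 < N"
    and R: "R \<le> 8 * (a + b + c)" "N\<^sup>2 \<le> R"
  shows "a powr (-1) * sqrt R \<le>
    5 * (a powr (-1) * (b powr (1/2) + c powr (1/2))) + 24 * (N powr (-2/3) * c powr (-1/6))"
proof (cases "b \<le> a \<and> c \<le> a")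
  case True
  have Rpos: "R > 0" using R(2) pos(4) by (smt (verit) zero_less_power)
  have Ra: "R / 24 \<le> a" using R(1) True by simp
  \<comment> \<open>Five sixths of the power go to \<open>R\<close>, leaving
    \<open>R powr (-1/3)\<close> after multiplication by \<open>sqrt R\<close>. One sixth goes to
    \<open>c\<close>, matching the exponent 1/3 - 1/2 of the \<open>Y\<close> part of the norm with
    parameter 1/3.\<close>
  have "a powr (-1) = a powr (-5/6) * a powr (-1/6)" by (simp flip: powr_add)
  also have "\<dots> \<le> (R / 24) powr (-5/6) * c powr (-1/6)"
    using True Ra Rpos pos by (intro mult_mono powr_mono2') auto
  finally have "a powr (-1) * sqrt R \<le> (R / 24) powr (-5/6) * c powr (-1/6) * sqrt R"
    by (rule mult_right_mono) (use Rpos in simp)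
  also have "\<dots> = 24 powr (5/6) * (R powr (-5/6) * R powr (1/2)) * c powr (-1/6)"
    using Rpos by (simp add: powr_divide powr_minus powr_half_sqrt field_simps)
  also have "R powr (-5/6) * R powr (1/2) = R powr (-1/3)" by (simp flip: powr_add)
  also have "24 powr (5/6) * R powr (-1/3) * c powr (-1/6) \<le> 24 powr 1 * (N\<^sup>2) powr (-1/3) * c powr (-1/6)"
    using R(2) pos by (intro mult_mono powr_mono2' powr_mono) auto
  also have "(N\<^sup>2) powr (-1/3) = N powr (-2/3)"
    using pos by (simp add: powr_powr flip: powr_numeral)
  finally have "a powr (-1) * sqrt R \<le> 24 * (N powr (-2/3) * c powr (-1/6))"
    by (simp add: mult.assoc)
  moreover have "0 \<le> 5 * (a powr (-1) * (b powr (1/2) + c powr (1/2)))" by simp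
  ultimately show ?thesis by linarith
next
  case False
  have half: "sqrt R \<le> 5 * x powr (1/2)" if "R \<le> 24 * x" "0 < x" for x
  proof -
    \<comment> \<open>24 comes from three times 8 and is rounded up to a perfect square.\<close>
    have "sqrt R \<le> sqrt (25 * x)" using that by (intro real_sqrt_le_mono) linarith
    then show ?thesis using that by (simp add: real_sqrt_mult powr_half_sqrt)
  qed
  have "R \<le> 24 * b \<or> R \<le> 24 * c" using False R(1) by argo
  then have "sqrt R \<le> 5 * b powr (1/2) \<or> sqrt R \<le> 5 * c powr (1/2)"
    using half pos by blast
  moreover have "0 \<le> b powr (1/2)" "0 \<le> c powr (1/2)" by simp_all
  ultimately have "sqrt R \<le> 5 * (b powr (1/2) + c powr (1/2))" by argo
  then have "a powr (-1) * sqrt R \<le> a powr (-1) * (5 * (b powr (1/2) + c powr (1/2)))"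
    by (rule mult_left_mono) simp
  moreover have "0 \<le> 24 * (N powr (-2/3) * c powr (-1/6))" by simp
  ultimately show ?thesis unfolding mult.left_commute[of "a powr (-1)" 5] by linarith
qed

lemma res_weight_le_Y:
  assumes "m \<noteq> 0" "k \<noteq> 0"
  shows "wt (t + u - disp (m + k)) (-1) * res_weight m k \<le>
    5 * (wt (t + u - disp (m + k)) (-1) * (wt (t - disp m) (1/2) + wt (u - disp k) (1/2)))
    + 24 * (wt (m + k) (-2/3) * wt (u - disp k) (-1/6))"
proof -
  define a b c where "a = bracket (t + u - disp (m + k))" and "b = bracket (t - disp m)"
    and "c = bracket (u - disp k)"
  define R where "R = bracket (m + k) * bracket m * bracket k"
  have "(bracket (m + k))\<^sup>2 \<le> R"
    using mult_left_mono[OF bracket_mult_ge, of "bracket (m + k)" m k]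
    by (simp add: R_def power2_eq_square less_imp_le mult.assoc)
  moreover have "R \<le> 8 * (a + b + c)"
    unfolding R_def a_def b_def c_def by (rule resonance_lower_bound[OF assms])
  ultimately have le: "a powr (-1) * sqrt R \<le> 5 * (a powr (-1) * (b powr (1/2) + c powr (1/2)))
      + 24 * (bracket (m + k) powr (-2/3) * c powr (-1/6))"
    by (intro res_weight_le_Y_real) (simp_all add: a_def b_def c_def)
  have ennreal_le: "ennreal x * ennreal y \<le> 5 * (ennreal x * (ennreal z + ennreal z')) + 24 * (ennreal w * ennreal w')"
    if "x * y \<le> 5 * (x * (z + z')) + 24 * (w * w')" "0 \<le> x" "0 \<le> y" "0 \<le> z" "0 \<le> z'" "0 \<le> w" "0 \<le> w'"
    for x y z z' w w'
    using ennreal_leI[OF that(1)] that(2-) by (simp add: ennreal_mult ennreal_mult')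
  have "R \<ge> 0" by (simp add: R_def less_imp_le)
  then show ?thesis
    unfolding wt_def res_weight_eq R_def[symmetric] a_def[symmetric] b_def[symmetric] c_def[symmetric]
    by (intro ennreal_le le) simp_all
qed

section \<open>Bilinear estimates for convolutions\<close>

text \<open>Squared norms without frequency weight; powers of \<open>bracket n\<close> enter
  separately through \<open>freq_mult\<close>.\<close>

definition Xsq :: "real \<Rightarrow> (int \<times> int \<Rightarrow> ennreal) \<Rightarrow> ennreal" where
  "Xsq b F = (\<Sum>\<^sup>+x. (wt (modulation x) b * F x)\<^sup>2)"

definition Ysq :: "real \<Rightarrow> (int \<times> int \<Rightarrow> ennreal) \<Rightarrow> ennreal" where
  "Ysq b F = (\<Sum>\<^sup>+n. (\<Sum>\<^sup>+t. wt (modulation (n, t)) b * F (n, t))\<^sup>2)"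

definition mod_mult :: "real \<Rightarrow> (int \<times> int \<Rightarrow> ennreal) \<Rightarrow> int \<times> int \<Rightarrow> ennreal" where
  "mod_mult b F x = wt (modulation x) b * F x"

definition conv :: "(int \<times> int \<Rightarrow> ennreal) \<Rightarrow> (int \<times> int \<Rightarrow> ennreal) \<Rightarrow> int \<times> int \<Rightarrow> ennreal" where
  "conv F G z = (\<Sum>\<^sup>+x. F x * G (z - x))"

lemma power2_mono_ennreal: "x \<le> y \<Longrightarrow> x\<^sup>2 \<le> y\<^sup>2" for x y :: ennreal
  by (simp add: power2_eq_square mult_mono)

lemma power2_add_le_ennreal: "(x + y)\<^sup>2 \<le> 2 * (x\<^sup>2 + y\<^sup>2)" for x y :: ennreal
proof (cases "x = top \<or> y = top")
  case True
  then show ?thesis by (auto simp: power2_eq_square ennreal_mult_top)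
next
  case False
  then obtain a b where ab: "x = ennreal a" "0 \<le> a" "y = ennreal b" "0 \<le> b"
    by (metis ennreal_cases)
  have "(a + b)\<^sup>2 \<le> 2 * (a\<^sup>2 + b\<^sup>2)"
    using sum_squares_bound[of a b] by (simp add: power2_eq_square algebra_simps)
  then have "ennreal ((a + b)\<^sup>2) \<le> ennreal (2 * (a\<^sup>2 + b\<^sup>2))" by (rule ennreal_leI)
  also have "\<dots> = 2 * (x\<^sup>2 + y\<^sup>2)" using ab by (simp add: ennreal_power ennreal_mult' distrib_left)
  finally show ?thesis using ab by (simp add: ennreal_power flip: ennreal_plus)
qed

lemma Xsq_mono: "(\<And>x. F x \<le> G x) \<Longrightarrow> Xsq b F \<le> Xsq b G"
  unfolding Xsq_def by (intro nn_integral_mono power2_mono_ennreal mult_left_mono) auto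

lemma Xsq_mono_exp: "b \<le> c \<Longrightarrow> Xsq b F \<le> Xsq c F"
  unfolding Xsq_def by (intro nn_integral_mono power2_mono_ennreal mult_right_mono wt_mono) auto

lemma Xsq_mod_mult: "Xsq b (mod_mult c F) = Xsq (b + c) F"
  by (simp add: Xsq_def mod_mult_def wt_add mult.assoc)

lemma Xsq_add: "Xsq b (\<lambda>x. F x + G x) \<le> 2 * (Xsq b F + Xsq b G)"
proof -
  have "Xsq b (\<lambda>x. F x + G x) \<le>
      (\<Sum>\<^sup>+x. 2 * ((wt (modulation x) b * F x)\<^sup>2 + (wt (modulation x) b * G x)\<^sup>2))"
    unfolding Xsq_def distrib_left by (intro nn_integral_mono power2_add_le_ennreal[unfolded distrib_left])
  also have "\<dots> = 2 * (Xsq b F + Xsq b G)"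
    by (simp add: Xsq_def nn_integral_cmult nn_integral_add)
  finally show ?thesis .
qed

lemma Xsq_cmult: "Xsq b (\<lambda>x. c * F x) = c\<^sup>2 * Xsq b F"
  by (simp add: Xsq_def power_mult_distrib nn_integral_cmult mult.left_commute[of _ "c\<^sup>2"])

lemma Ysq_mono: "(\<And>x. F x \<le> G x) \<Longrightarrow> Ysq b F \<le> Ysq b G"
  unfolding Ysq_def by (intro nn_integral_mono power2_mono_ennreal mult_left_mono) auto

lemma Ysq_mod_mult: "Ysq b (mod_mult c F) = Ysq (b + c) F"
  by (simp add: Ysq_def mod_mult_def wt_add mult.assoc)

lemma Ysq_add: "Ysq b (\<lambda>x. F x + G x) \<le> 2 * (Ysq b F + Ysq b G)"
proof -
  have "Ysq b (\<lambda>x. F x + G x) \<le> (\<Sum>\<^sup>+n. 2 * ((\<Sum>\<^sup>+t. wt (modulation (n, t)) b * F (n, t))\<^sup>2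
      + (\<Sum>\<^sup>+t. wt (modulation (n, t)) b * G (n, t))\<^sup>2))"
    unfolding Ysq_def distrib_left
    by (subst nn_integral_add) (auto intro!: nn_integral_mono power2_add_le_ennreal[unfolded distrib_left])
  also have "\<dots> = 2 * (Ysq b F + Ysq b G)"
    by (simp add: Ysq_def nn_integral_cmult nn_integral_add)
  finally show ?thesis .
qed

lemma Ysq_cmult: "Ysq b (\<lambda>x. c * F x) = c\<^sup>2 * Ysq b F"
  by (simp add: Ysq_def power_mult_distrib nn_integral_cmult mult.left_commute[of _ c])

lemma conv_commute: "conv F G = conv G F"
proof
  fix z
  show "conv F G z = conv G F z"
    unfolding conv_def esum_reflect[of "\<lambda>x. F x * G (z - x)" z, symmetric]
    by (simp add: mult.commute)
qed

text \<open>Serves the region where the output modulation dominates: its half power cancels the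
  output weight of exponent -1/2, so a plain square sum remains to be bounded.\<close>

lemma conv_L2_bound: "\<exists>C<top. \<forall>F G. Xsq 0 (conv F G) \<le> C * Xsq (1/2) F * Xsq (1/3) G"
proof -
  obtain C where C: "C < top"
    "\<And>z. (\<Sum>\<^sup>+x. (wt (modulation x) (-11/24) * wt (modulation (z - x)) (-1/3))\<^sup>2) \<le> C"
    using kernel_bound by auto
  show ?thesis
  proof (intro exI[of _ C] conjI allI C(1))
    fix F G
    \<comment> \<open>Each factor is multiplied by a modulation weight whose inverse goes into the
      kernel.\<close>
    have "Xsq 0 (conv F G) = (\<Sum>\<^sup>+z. (\<Sum>\<^sup>+x. (wt (modulation x) (-11/24) * wt (modulation (z - x)) (-1/3)) *
        (mod_mult (11/24) F x * mod_mult (1/3) G (z - x)))\<^sup>2)"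
    proof -
      have "wt (modulation x) (-11/24) * wt (modulation (z - x)) (-1/3) *
        (mod_mult (11/24) F x * mod_mult (1/3) G (z - x)) =
        wt (modulation x) (-11/24 + 11/24) * wt (modulation (z - x)) (-1/3 + 1/3) * (F x * G (z - x))" for x z
        unfolding wt_add mod_mult_def by (simp only: mult_ac)
      then show ?thesis by (simp add: Xsq_def conv_def)
    qed
    also have "\<dots> \<le> C * (\<Sum>\<^sup>+x. (mod_mult (11/24) F x)\<^sup>2) * (\<Sum>\<^sup>+x. (mod_mult (1/3) G x)\<^sup>2)"
      by (rule bilinear_L2_bound[OF C(2)])
    also have "\<dots> = C * Xsq (11/24) F * Xsq (1/3) G" by (simp add: Xsq_def mod_mult_def)
    also have "\<dots> \<le> C * Xsq (1/2) F * Xsq (1/3) G"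
      by (intro mult_right_mono mult_left_mono Xsq_mono_exp) auto
    finally show "Xsq 0 (conv F G) \<le> C * Xsq (1/2) F * Xsq (1/3) G" .
  qed
qed

text \<open>Serves the region where the modulation of a factor dominates: \<open>F\<close> will
  carry that half power, so only its square sum enters and the output weight must replace it in the
  kernel. Vanishing of \<open>F\<close> at frequency 0 excludes the degenerate quadratic.\<close>

lemma conv_dual_bound: "\<exists>C<top. \<forall>F G. (\<forall>x. fst x = 0 \<longrightarrow> F x = 0) \<longrightarrow>
  Xsq (-11/24) (conv F G) \<le> C * Xsq 0 F * Xsq (1/3) G"
proof -
  obtain C where C: "C < top" "\<And>x. fst x \<noteq> 0 \<Longrightarrow>
      (\<Sum>\<^sup>+z. (wt (modulation z) (-11/24) * wt (modulation (z - x)) (-1/3))\<^sup>2) \<le> C"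
    using kernel_bound_dual by auto
  show ?thesis
  proof (intro exI[of _ C] conjI allI impI C(1))
    fix F G :: "int \<times> int \<Rightarrow> ennreal" assume F: "\<forall>x. fst x = 0 \<longrightarrow> F x = 0"
    have "Xsq (-11/24) (conv F G) = (\<Sum>\<^sup>+z. (\<Sum>\<^sup>+x. (wt (modulation z) (-11/24) * wt (modulation (z - x)) (-1/3)) *
        (F x * mod_mult (1/3) G (z - x)))\<^sup>2)"
    proof -
      have "wt (modulation z) (-11/24) * wt (modulation (z - x)) (-1/3) *
        (F x * mod_mult (1/3) G (z - x)) =
        wt (modulation z) (-11/24) * (wt (modulation (z - x)) (-1/3 + 1/3) * (F x * G (z - x)))" for x z
        unfolding wt_add mod_mult_def by (simp only: mult_ac)
      then show ?thesis by (simp add: Xsq_def conv_def nn_integral_cmult)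
    qed
    also have "\<dots> \<le> C * (\<Sum>\<^sup>+x. (F x)\<^sup>2) * (\<Sum>\<^sup>+x. (mod_mult (1/3) G x)\<^sup>2)"
      by (rule bilinear_L2_bound_dual) (use C(2) F in blast)
    also have "\<dots> = C * Xsq 0 F * Xsq (1/3) G" by (simp add: Xsq_def mod_mult_def)
    finally show "Xsq (-11/24) (conv F G) \<le> C * Xsq 0 F * Xsq (1/3) G" .
  qed
qed

text \<open>Cauchy-Schwarz in time at each frequency costs the weight with exponent -13/24, whose
  square is summable since 13/12 > 1. This is where having 11/24 rather than 1/2 in the dual bound
  pays off.\<close>

lemma Ysq_le_Xsq: "\<exists>C<top. \<forall>F. Ysq (-1) F \<le> C * Xsq (-11/24) F"
proof (intro exI[of _ "\<Sum>\<^sup>+n. wt n (- (13/12))"] conjI allI)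
  show "(\<Sum>\<^sup>+n. wt n (- (13/12))) < top" by (rule esum_wt_finite) simp
  fix F
  have "Ysq (-1) F \<le> (\<Sum>\<^sup>+n. (\<Sum>\<^sup>+n. wt n (- (13/12))) * (\<Sum>\<^sup>+t. (wt (modulation (n, t)) (-11/24) * F (n, t))\<^sup>2))"
    unfolding Ysq_def
  proof (rule nn_integral_mono)
    fix n
    have "wt y (-1) = wt y (-13/24) * wt y (-11/24)" for y by (simp flip: wt_add)
    then have "(\<Sum>\<^sup>+t. wt (modulation (n, t)) (-1) * F (n, t))\<^sup>2 =
        (\<Sum>\<^sup>+t. wt (modulation (n, t)) (-13/24) * (wt (modulation (n, t)) (-11/24) * F (n, t)))\<^sup>2"
      by (simp add: mult.assoc)
    also have "\<dots> \<le> (\<Sum>\<^sup>+t. (wt (modulation (n, t)) (-13/24))\<^sup>2) *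
        (\<Sum>\<^sup>+t. (wt (modulation (n, t)) (-11/24) * F (n, t))\<^sup>2)"
      by (rule esum_Cauchy_Schwarz)
    also have "(\<Sum>\<^sup>+t. (wt (modulation (n, t)) (-13/24))\<^sup>2) = (\<Sum>\<^sup>+n. wt n (- (13/12)))"
      by (simp add: wt_power2 modulation_def esum_shift[of "\<lambda>t. wt t _"])
    finally show "(\<Sum>\<^sup>+t. wt (modulation (n, t)) (-1) * F (n, t))\<^sup>2 \<le>
        (\<Sum>\<^sup>+n. wt n (- (13/12))) * (\<Sum>\<^sup>+t. (wt (modulation (n, t)) (-11/24) * F (n, t))\<^sup>2)" .
  qed
  also have "\<dots> = (\<Sum>\<^sup>+n. wt n (- (13/12))) * Xsq (-11/24) F"
    by (simp add: nn_integral_cmult Xsq_def flip: esum_pair)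
  finally show "Ysq (-1) F \<le> (\<Sum>\<^sup>+n. wt n (- (13/12))) * Xsq (-11/24) F" .
qed

lemma esum_conv:
  "(\<Sum>\<^sup>+t. conv F G (n, t)) = (\<Sum>\<^sup>+m. (\<Sum>\<^sup>+t. F (m, t)) * (\<Sum>\<^sup>+t. G (n - m, t)))"
proof -
  have "(\<Sum>\<^sup>+t. conv F G (n, t)) = (\<Sum>\<^sup>+x. F x * (\<Sum>\<^sup>+t. G ((n, t) - x)))"
    unfolding conv_def by (subst esum_swap) (simp add: nn_integral_cmult)
  also have "\<dots> = (\<Sum>\<^sup>+m. \<Sum>\<^sup>+u. F (m, u) * (\<Sum>\<^sup>+t. G (n - m, t)))"
    unfolding esum_pair[symmetric] by (simp add: esum_shift[of "\<lambda>t. G (_, t)"])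
  finally show ?thesis by (simp add: nn_integral_multc)
qed

text \<open>Summing in time turns the convolution into one in space alone, which Cauchy-Schwarz
  bounds uniformly in \<open>n\<close>. The weight then supplies square summability because 4/3 >
  1.\<close>

lemma conv_Ysq_bound:
  "\<exists>C<top. \<forall>F G. Ysq 0 (\<lambda>z. wt (fst z) (-2/3) * conv F G z) \<le> C * Ysq 0 F * Ysq 0 G"
proof (intro exI[of _ "\<Sum>\<^sup>+n. wt n (- (4/3))"] conjI allI)
  show "(\<Sum>\<^sup>+n. wt n (- (4/3))) < top" by (rule esum_wt_finite) simp
  fix F G
  have "Ysq 0 (\<lambda>z. wt (fst z) (-2/3) * conv F G z) \<le> (\<Sum>\<^sup>+n. wt n (- (4/3)) * (Ysq 0 F * Ysq 0 G))"
    unfolding Ysq_def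
  proof (rule nn_integral_mono)
    fix n
    let ?f = "\<lambda>m. \<Sum>\<^sup>+t. F (m, t)" and ?g = "\<lambda>m. \<Sum>\<^sup>+t. G (m, t)"
    have "(\<Sum>\<^sup>+t. wt (modulation (n, t)) 0 * (wt (fst (n, t)) (-2/3) * conv F G (n, t)))\<^sup>2 =
        wt n (- (4/3)) * (\<Sum>\<^sup>+m. ?f m * ?g (n - m))\<^sup>2"
      by (simp add: nn_integral_cmult esum_conv power_mult_distrib wt_power2)
    also have "\<dots> \<le> wt n (- (4/3)) * ((\<Sum>\<^sup>+m. (?f m)\<^sup>2) * (\<Sum>\<^sup>+m. (?g (n - m))\<^sup>2))"
      by (intro mult_left_mono esum_Cauchy_Schwarz) simp
    also have "(\<Sum>\<^sup>+m. (?g (n - m))\<^sup>2) = (\<Sum>\<^sup>+m. (?g m)\<^sup>2)"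
      by (rule esum_reflect)
    finally show "(\<Sum>\<^sup>+t. wt (modulation (n, t)) 0 * (wt (fst (n, t)) (-2/3) * conv F G (n, t)))\<^sup>2 \<le>
        wt n (- (4/3)) * ((\<Sum>\<^sup>+n. (\<Sum>\<^sup>+t. wt (modulation (n, t)) 0 * F (n, t))\<^sup>2) *
          (\<Sum>\<^sup>+n. (\<Sum>\<^sup>+t. wt (modulation (n, t)) 0 * G (n, t))\<^sup>2))" by simp
  qed
  then show "Ysq 0 (\<lambda>z. wt (fst z) (-2/3) * conv F G z) \<le> (\<Sum>\<^sup>+n. wt n (- (4/3))) * Ysq 0 F * Ysq 0 G"
    by (simp add: nn_integral_multc mult.assoc)
qed

section \<open>Splitting the convolution according to the modulations\<close>

lemma wt_conv_le:
  assumes "s \<ge> 1/2"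
  shows "wt (fst z) s * conv F G z \<le> (\<Sum>\<^sup>+x. res_weight (fst x) (fst (z - x)) *
    ((wt (fst x) (s - 1) * F x) * (wt (fst (z - x)) (s - 1) * G (z - x))))"
proof -
  have "wt (fst z) s * conv F G z = (\<Sum>\<^sup>+x. wt (fst z) s * (F x * G (z - x)))"
    by (simp add: conv_def nn_integral_cmult)
  also have "\<dots> \<le> (\<Sum>\<^sup>+x. res_weight (fst x) (fst (z - x)) * (wt (fst x) (s - 1) * wt (fst (z - x)) (s - 1))
      * (F x * G (z - x)))"
  proof (intro nn_integral_mono mult_right_mono)
    fix x
    show "wt (fst z) s \<le> res_weight (fst x) (fst (z - x)) * (wt (fst x) (s - 1) * wt (fst (z - x)) (s - 1))"
      using wt_le_res_weight[OF assms, of "fst x" "fst (z - x)"] by simp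
  qed simp
  finally show ?thesis by (simp only: mult_ac)
qed

lemma modulation_res_weight_le:
  assumes "fst x \<noteq> 0" "fst (z - x) \<noteq> 0"
  shows "res_weight (fst x) (fst (z - x)) \<le>
    3 * (wt (modulation z) (1/2) + wt (modulation x) (1/2) + wt (modulation (z - x)) (1/2))"
  using res_weight_le[OF assms, of "snd x" "snd (z - x)"] by (simp add: modulation_def)

lemma modulation_res_weight_le_Y:
  assumes "fst x \<noteq> 0" "fst (z - x) \<noteq> 0"
  shows "wt (modulation z) (-1) * res_weight (fst x) (fst (z - x)) \<le>
    5 * (wt (modulation z) (-1) * (wt (modulation x) (1/2) + wt (modulation (z - x)) (1/2)))
    + 24 * (wt (fst z) (-2/3) * wt (modulation (z - x)) (-1/6))"
  using res_weight_le_Y[OF assms, of "snd x" "snd (z - x)"] by (simp add: modulation_def)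

definition zero_mean :: "(int \<times> int \<Rightarrow> ennreal) \<Rightarrow> bool" where
  "zero_mean F \<longleftrightarrow> (\<forall>x. fst x = 0 \<longrightarrow> F x = 0)"

definition freq_mult :: "real \<Rightarrow> (int \<times> int \<Rightarrow> ennreal) \<Rightarrow> int \<times> int \<Rightarrow> ennreal" where
  "freq_mult s F x = wt (fst x) s * F x"

lemma zero_mean_mult:
  "zero_mean F \<Longrightarrow> zero_mean (freq_mult s F)" "zero_mean F \<Longrightarrow> zero_mean (mod_mult b F)"
  by (simp_all add: zero_mean_def freq_mult_def mod_mult_def)

lemma freq_mult_conv_le:
  assumes "s \<ge> 1/2" "zero_mean F" "zero_mean G"
  defines "F' \<equiv> freq_mult (s - 1) F" and "G' \<equiv> freq_mult (s - 1) G"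
  shows "freq_mult s (conv F G) z \<le>
    3 * (mod_mult (1/2) (conv F' G') z + (conv (mod_mult (1/2) F') G' z + conv F' (mod_mult (1/2) G') z))"
proof -
  have "freq_mult s (conv F G) z \<le> (\<Sum>\<^sup>+x. res_weight (fst x) (fst (z - x)) * (F' x * G' (z - x)))"
    using wt_conv_le[OF assms(1)] by (simp add: freq_mult_def F'_def G'_def)
  also have "\<dots> \<le> (\<Sum>\<^sup>+x. 3 * (wt (modulation z) (1/2) + wt (modulation x) (1/2) + wt (modulation (z - x)) (1/2))
      * (F' x * G' (z - x)))"
  proof (rule nn_integral_mono)
    fix x
    show "res_weight (fst x) (fst (z - x)) * (F' x * G' (z - x)) \<le>
      3 * (wt (modulation z) (1/2) + wt (modulation x) (1/2) + wt (modulation (z - x)) (1/2))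
        * (F' x * G' (z - x))"
    \<comment> \<open>A term with a zero input frequency vanishes by the zero mean assumption; all
      others admit the resonance bound.\<close>
    proof (cases "fst x = 0 \<or> fst (z - x) = 0")
      case True
      then have "F' x * G' (z - x) = 0"
        using zero_mean_mult(1)[OF assms(2)] zero_mean_mult(1)[OF assms(3)]
        unfolding F'_def G'_def zero_mean_def by (metis mult_zero_left mult_zero_right)
      then show ?thesis by (simp only: mult_zero_right order_refl)
    next
      case False
      then show ?thesis by (intro mult_right_mono modulation_res_weight_le) auto
    qed
  qed
  also have "\<dots> = (\<Sum>\<^sup>+x. 3 * (wt (modulation z) (1/2) * (F' x * G' (z - x))
      + ((wt (modulation x) (1/2) * F' x) * G' (z - x) + F' x * (wt (modulation (z - x)) (1/2) * G' (z - x)))))"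
    by (simp only: distrib_left distrib_right mult_ac add_ac)
  also have "\<dots> = 3 * (mod_mult (1/2) (conv F' G') z +
      (conv (mod_mult (1/2) F') G' z + conv F' (mod_mult (1/2) G') z))"
    by (simp add: nn_integral_cmult nn_integral_add conv_def mod_mult_def)
  finally show ?thesis .
qed

text \<open>Counterpart for the \<open>Y\<close> part: the output-dominated contribution becomes
  frequency decay together with a negative modulation power on the second factor, ready for
  \<open>conv_Ysq_bound\<close>.\<close>

lemma mod_mult_freq_mult_conv_le:
  assumes "s \<ge> 1/2" "zero_mean F" "zero_mean G"
  defines "F' \<equiv> freq_mult (s - 1) F" and "G' \<equiv> freq_mult (s - 1) G"
  shows "mod_mult (-1) (freq_mult s (conv F G)) z \<le>
    5 * mod_mult (-1) (\<lambda>z. conv (mod_mult (1/2) F') G' z + conv F' (mod_mult (1/2) G') z) z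
    + 24 * freq_mult (-2/3) (conv F' (mod_mult (-1/6) G')) z"
proof -
  have "mod_mult (-1) (freq_mult s (conv F G)) z \<le>
      wt (modulation z) (-1) * (\<Sum>\<^sup>+x. res_weight (fst x) (fst (z - x)) * (F' x * G' (z - x)))"
    using wt_conv_le[OF assms(1)] by (simp add: mod_mult_def freq_mult_def F'_def G'_def mult_left_mono)
  also have "\<dots> = (\<Sum>\<^sup>+x. wt (modulation z) (-1) * res_weight (fst x) (fst (z - x)) * (F' x * G' (z - x)))"
    by (simp add: nn_integral_cmult mult.assoc)
  also have "\<dots> \<le> (\<Sum>\<^sup>+x. (5 * (wt (modulation z) (-1) * (wt (modulation x) (1/2) + wt (modulation (z - x)) (1/2)))
    + 24 * (wt (fst z) (-2/3) * wt (modulation (z - x)) (-1/6))) * (F' x * G' (z - x)))"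
  proof (rule nn_integral_mono)
    fix x
    show "wt (modulation z) (-1) * res_weight (fst x) (fst (z - x)) * (F' x * G' (z - x)) \<le>
      (5 * (wt (modulation z) (-1) * (wt (modulation x) (1/2) + wt (modulation (z - x)) (1/2)))
    + 24 * (wt (fst z) (-2/3) * wt (modulation (z - x)) (-1/6))) * (F' x * G' (z - x))"
    proof (cases "fst x = 0 \<or> fst (z - x) = 0")
      case True
      then have "F' x * G' (z - x) = 0"
        using zero_mean_mult(1)[OF assms(2)] zero_mean_mult(1)[OF assms(3)]
        unfolding F'_def G'_def zero_mean_def by (metis mult_zero_left mult_zero_right)
      then show ?thesis by (simp only: mult_zero_right order_refl)
    next
      case False
      then show ?thesis by (intro mult_right_mono modulation_res_weight_le_Y) auto
    qed
  qed
  also have "\<dots> = (\<Sum>\<^sup>+x. 5 * (wt (modulation z) (-1) * ((wt (modulation x) (1/2) * F' x) * G' (z - x)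
        + F' x * (wt (modulation (z - x)) (1/2) * G' (z - x))))
      + 24 * (wt (fst z) (-2/3) * (F' x * (wt (modulation (z - x)) (-1/6) * G' (z - x)))))"
    by (simp only: distrib_left distrib_right mult_ac add_ac)
  also have "\<dots> = 5 * mod_mult (-1) (\<lambda>z. conv (mod_mult (1/2) F') G' z + conv F' (mod_mult (1/2) G') z) z
    + 24 * freq_mult (-2/3) (conv F' (mod_mult (-1/6) G')) z"
    by (simp add: nn_integral_cmult nn_integral_add conv_def mod_mult_def freq_mult_def)
  finally show ?thesis .
qed

text \<open>\<open>P\<close> collects the squared \<open>X\<close> products on the right of the
  theorem. The extra product has exponents 0 = 1/2 - 1/2 and -1/6 = 1/3 - 1/2, those of the
  \<open>Y\<close> parts of the norms with parameters 1/2 and 1/3.\<close>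

lemma bilinear_estimates:
  assumes s: "s \<ge> 1/2"
  shows "\<exists>C<top. \<forall>F G. zero_mean F \<longrightarrow> zero_mean G \<longrightarrow>
    (let F' = freq_mult (s - 1) F; G' = freq_mult (s - 1) G; H = freq_mult s (conv F G);
         P = Xsq (1/2) F' * Xsq (1/3) G' + Xsq (1/3) F' * Xsq (1/2) G'
     in Xsq (-1/2) H \<le> C * P \<and> Ysq (-1) H \<le> C * (P + Ysq 0 F' * Ysq (-1/6) G'))"
proof -
  obtain C1 where C1: "C1 < top" "\<And>F G. Xsq 0 (conv F G) \<le> C1 * Xsq (1/2) F * Xsq (1/3) G"
    using conv_L2_bound by auto
  obtain C2 where C2: "C2 < top"
    "\<And>F G. zero_mean F \<Longrightarrow> Xsq (-11/24) (conv F G) \<le> C2 * Xsq 0 F * Xsq (1/3) G"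
    using conv_dual_bound unfolding zero_mean_def by blast
  obtain C3 where C3: "C3 < top" "\<And>F. Ysq (-1) F \<le> C3 * Xsq (-11/24) F"
    using Ysq_le_Xsq by auto
  obtain C4 where C4: "C4 < top"
    "\<And>F G. Ysq 0 (freq_mult (-2/3) (conv F G)) \<le> C4 * Ysq 0 F * Ysq 0 G"
    using conv_Ysq_bound unfolding freq_mult_def by auto
  \<comment> \<open>Squaring the factors 3, 5 and 24 and paying 2 for splitting a square gives 18,
    50 and 1152; \<open>4 * C2\<close> accounts for the two parts of \<open>Q\<close> below.\<close>
  define D where "D = 18 * (C1 + 4 * C2)"
  define E where "E = 50 * (C3 * (4 * C2)) + 1152 * C4"
  have fin: "D + E < top"
    using C1(1) C2(1) C3(1) C4(1) by (simp add: D_def E_def ennreal_mult_less_top)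
  show ?thesis
  proof (intro exI[of _ "D + E"] conjI allI impI fin)
    fix F G assume FG: "zero_mean F" "zero_mean G"
    define F' G' where "F' = freq_mult (s - 1) F" and "G' = freq_mult (s - 1) G"
    define H where "H = freq_mult s (conv F G)"
    define P where "P = Xsq (1/2) F' * Xsq (1/3) G' + Xsq (1/3) F' * Xsq (1/2) G'"
    define Q where "Q = (\<lambda>z. conv (mod_mult (1/2) F') G' z + conv F' (mod_mult (1/2) G') z)"
    have zm: "zero_mean (mod_mult (1/2) F')" "zero_mean (mod_mult (1/2) G')"
      using FG by (simp_all add: F'_def G'_def zero_mean_mult)
    \<comment> \<open>\<open>Q\<close> gathers the two regions where a factor's modulation
      dominates; the second reduces to the first by commutativity. This one bound serves both norms
      of \<open>H\<close>.\<close>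
    have Q: "Xsq (-11/24) Q \<le> 4 * C2 * P"
    proof -
      have "Xsq (-11/24) (conv (mod_mult (1/2) F') G') \<le> C2 * (Xsq (1/2) F' * Xsq (1/3) G')"
        using C2(2)[OF zm(1), of G'] by (simp add: Xsq_mod_mult mult.assoc)
      also have "\<dots> \<le> C2 * P" unfolding P_def by (intro mult_left_mono) auto
      finally have 1: "Xsq (-11/24) (conv (mod_mult (1/2) F') G') \<le> C2 * P" .
      have "Xsq (-11/24) (conv F' (mod_mult (1/2) G')) \<le> C2 * (Xsq (1/3) F' * Xsq (1/2) G')"
        using C2(2)[OF zm(2), of F'] unfolding conv_commute[of F'] by (simp add: Xsq_mod_mult mult_ac)
      also have "\<dots> \<le> C2 * P" unfolding P_def by (intro mult_left_mono) auto
      finally have 2: "Xsq (-11/24) (conv F' (mod_mult (1/2) G')) \<le> C2 * P" .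
      have "Xsq (-11/24) Q \<le> 2 * (C2 * P + C2 * P)"
        unfolding Q_def by (intro order_trans[OF Xsq_add] mult_left_mono add_mono 1 2) simp
      also have "\<dots> = 4 * C2 * P" by (simp add: mult.assoc flip: mult_2)
      finally show ?thesis .
    qed
    have "Xsq (-1/2) H \<le> D * P"
    proof -
      have nine: "(3::ennreal)\<^sup>2 = 9" by simp
      have "Xsq (-1/2) H \<le> Xsq (-1/2) (\<lambda>z. 3 * (mod_mult (1/2) (conv F' G') z + Q z))"
        unfolding H_def Q_def F'_def G'_def by (intro Xsq_mono freq_mult_conv_le s FG)
      also have "\<dots> \<le> 9 * (2 * (Xsq (-1/2) (mod_mult (1/2) (conv F' G')) + Xsq (-1/2) Q))"
        unfolding Xsq_cmult nine by (intro mult_left_mono Xsq_add) simp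
      also have "\<dots> \<le> 9 * (2 * (C1 * P + 4 * C2 * P))"
      proof (intro mult_left_mono add_mono)
        have "Xsq (-1/2) (mod_mult (1/2) (conv F' G')) \<le> C1 * (Xsq (1/2) F' * Xsq (1/3) G')"
          using C1(2)[of F' G'] by (simp add: Xsq_mod_mult mult.assoc)
        also have "\<dots> \<le> C1 * P" unfolding P_def by (intro mult_left_mono) auto
        finally show "Xsq (-1/2) (mod_mult (1/2) (conv F' G')) \<le> C1 * P" .
        show "Xsq (-1/2) Q \<le> 4 * C2 * P"
          using Xsq_mono_exp[of "-1/2" "-11/24" Q] Q by simp
      qed auto
      also have "\<dots> = D * P" by (simp add: D_def algebra_simps)
      finally show ?thesis .
    qed
    then have X: "Xsq (-1/2) H \<le> (D + E) * P"
      by (rule order_trans) (intro mult_right_mono, simp_all)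
    define V where "V = freq_mult (-2/3) (conv F' (mod_mult (-1/6) G'))"
    have V: "Ysq 0 V \<le> C4 * (Ysq 0 F' * Ysq (-1/6) G')"
      using C4(2)[of F' "mod_mult (-1/6) G'"] by (simp add: V_def Ysq_mod_mult mult.assoc)
    have "Ysq (-1) H = Ysq 0 (mod_mult (-1) H)" by (simp add: Ysq_mod_mult)
    also have "\<dots> \<le> Ysq 0 (\<lambda>z. 5 * mod_mult (-1) Q z + 24 * V z)"
      unfolding H_def Q_def F'_def G'_def V_def by (intro Ysq_mono mod_mult_freq_mult_conv_le s FG)
    also have "\<dots> \<le> 2 * (25 * Ysq (-1) Q + 576 * Ysq 0 V)"
      using Ysq_add[of 0 "\<lambda>z. 5 * mod_mult (-1) Q z" "\<lambda>z. 24 * V z"]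
      by (simp add: Ysq_cmult Ysq_mod_mult)
    also have "\<dots> \<le> 2 * (25 * (C3 * (4 * C2 * P)) + 576 * (C4 * (Ysq 0 F' * Ysq (-1/6) G')))"
      by (intro mult_left_mono add_mono V order_trans[OF C3(2)] Q) auto
    also have "\<dots> = (50 * (C3 * (4 * C2))) * P + (1152 * C4) * (Ysq 0 F' * Ysq (-1/6) G')"
      by (simp add: distrib_left flip: mult.assoc)
    also have "\<dots> \<le> (D + E) * P + (D + E) * (Ysq 0 F' * Ysq (-1/6) G')"
      by (intro add_mono mult_right_mono) (auto simp: E_def intro: add_increasing add_increasing2)
    finally have Y: "Ysq (-1) H \<le> (D + E) * (P + Ysq 0 F' * Ysq (-1/6) G')"
      by (simp add: distrib_left)
    show "let F' = freq_mult (s - 1) F; G' = freq_mult (s - 1) G; H = freq_mult s (conv F G);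
         P = Xsq (1/2) F' * Xsq (1/3) G' + Xsq (1/3) F' * Xsq (1/2) G'
     in Xsq (-1/2) H \<le> (D + E) * P \<and> Ysq (-1) H \<le> (D + E) * (P + Ysq 0 F' * Ysq (-1/6) G')"
      using X Y unfolding Let_def F'_def G'_def H_def P_def by blast
  qed
qed

section \<open>Passage to the norms\<close>

definition amp :: "fourier_coeffs \<Rightarrow> int \<times> int \<Rightarrow> ennreal" where
  "amp u x = ennreal (cmod (u (fst x) (snd x)))"

lemma ennsqrt_power2: "(ennsqrt x)\<^sup>2 = x"
  by (cases x) (auto simp: ennsqrt_def power2_eq_square ennreal_mult_top simp flip: ennreal_mult)

lemma power2_le_imp_le_ennreal:
  fixes x y :: ennreal
  assumes "x\<^sup>2 \<le> y\<^sup>2"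
  shows "x \<le> y"
proof (cases x)
  case (real a)
  note a = this
  show ?thesis
  proof (cases y)
    case (real b)
    with assms a have "a\<^sup>2 \<le> b\<^sup>2" by (simp add: ennreal_power)
    then have "a \<le> b" using \<open>0 \<le> b\<close> by (rule power2_le_imp_le)
    then show ?thesis using a real by (simp add: ennreal_leI)
  qed simp
next
  case top
  then show ?thesis using assms by (cases y) (simp_all add: power2_eq_square ennreal_mult_top top_unique flip: ennreal_mult)
qed

lemma X_norm_power2: "(X_norm s b u)\<^sup>2 = Xsq b (freq_mult s (amp u))"
proof -
  have "(X_norm s b u)\<^sup>2 = (\<Sum>\<^sup>+n. ennreal (bracket n powr (2 * s)) *
      (\<Sum>\<^sup>+t. ennreal (bracket (t - disp n) powr (2 * b) * (cmod (u n t))\<^sup>2)))"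
    unfolding X_norm_def ennsqrt_power2 infsum_eq_esum ..
  also have "\<dots> = (\<Sum>\<^sup>+n. wt n (2 * s) * (\<Sum>\<^sup>+t. wt (t - disp n) (2 * b) * (ennreal (cmod (u n t)))\<^sup>2))"
    by (simp add: wt_def ennreal_mult ennreal_power)
  also have "\<dots> = (\<Sum>\<^sup>+n. \<Sum>\<^sup>+t. (wt n s)\<^sup>2 * ((wt (t - disp n) b)\<^sup>2 * (ennreal (cmod (u n t)))\<^sup>2))"
    by (simp add: wt_power2 nn_integral_cmult)
  also have "\<dots> = (\<Sum>\<^sup>+n. \<Sum>\<^sup>+t. (wt (modulation (n, t)) b * freq_mult s (amp u) (n, t))\<^sup>2)"
    by (simp add: freq_mult_def amp_def modulation_def power_mult_distrib mult_ac)
  also have "\<dots> = Xsq b (freq_mult s (amp u))" unfolding Xsq_def by (rule esum_pair)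
  finally show ?thesis .
qed

lemma Y_norm_power2: "(Y_norm s b u)\<^sup>2 = Ysq b (freq_mult s (amp u))"
proof -
  have "(Y_norm s b u)\<^sup>2 = (\<Sum>\<^sup>+n. ennreal (bracket n powr (2 * s)) *
      (\<Sum>\<^sup>+t. ennreal (bracket (t - disp n) powr b * cmod (u n t)))\<^sup>2)"
    unfolding Y_norm_def ennsqrt_power2 infsum_eq_esum ..
  also have "\<dots> = (\<Sum>\<^sup>+n. (wt n s * (\<Sum>\<^sup>+t. wt (t - disp n) b * ennreal (cmod (u n t))))\<^sup>2)"
    by (simp add: power_mult_distrib wt_power2) (simp add: wt_def ennreal_mult)
  also have "\<dots> = Ysq b (freq_mult s (amp u))"
    by (simp add: Ysq_def freq_mult_def amp_def modulation_def mult.left_commute nn_integral_cmult)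
  finally show ?thesis .
qed

section \<open>Absolute convergence of the product\<close>

lemma summable_on_if_esum_norm_finite:
  fixes f :: "'a \<Rightarrow> complex"
  assumes "(\<Sum>\<^sup>+x. ennreal (cmod (f x))) < top"
  shows "f summable_on UNIV"
    and "ennreal (cmod (infsum f UNIV)) \<le> (\<Sum>\<^sup>+x. ennreal (cmod (f x)))"
proof -
  \<comment> \<open>A finite counting-measure integral of the modulus is Bochner integrability, from
    which absolute summability for \<open>infsum\<close> is transferred.\<close>
  have abs: "Infinite_Set_Sum.abs_summable_on f UNIV"
    using assms by (simp add: Infinite_Set_Sum.abs_summable_on_def integrable_iff_bounded)
  then have norm: "(\<lambda>x. cmod (f x)) summable_on UNIV"
    by (simp add: abs_summable_equivalent)
  then show "f summable_on UNIV" by (rule abs_summable_summable)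
  have "cmod (infsum f UNIV) \<le> (\<Sum>\<^sub>\<infinity>x. cmod (f x))"
    by (rule norm_infsum_bound[OF norm])
  also have "\<dots> = infsetsum (\<lambda>x. cmod (f x)) UNIV"
    using abs by (intro infsetsum_infsum[symmetric]) simp
  finally have "ennreal (cmod (infsum f UNIV)) \<le> ennreal (infsetsum (\<lambda>x. cmod (f x)) UNIV)"
    by (rule ennreal_leI)
  also have "\<dots> = (\<Sum>\<^sup>+x. ennreal (cmod (f x)))"
    using abs by (subst nn_integral_conv_infsetsum) auto
  finally show "ennreal (cmod (infsum f UNIV)) \<le> (\<Sum>\<^sup>+x. ennreal (cmod (f x)))" .
qed

lemma conv_amp_eq: "conv (amp u) (amp v) (n, t)
    = (\<Sum>\<^sup>+x. ennreal (cmod (case x of (m, r) \<Rightarrow> u m r * v (n - m) (t - r))))"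
  by (simp add: conv_def amp_def norm_mult ennreal_mult case_prod_beta)

lemma product_defined_if_conv_finite:
  assumes "\<And>z. conv (amp u) (amp v) z < top"
  shows "product_defined u v"
  unfolding product_defined_def
  using assms by (auto intro!: summable_on_if_esum_norm_finite(1) simp flip: conv_amp_eq)

lemma amp_product_le: "amp (product u v) z \<le> conv (amp u) (amp v) z"
proof (cases "conv (amp u) (amp v) z < top")
  case True
  then show ?thesis
    using summable_on_if_esum_norm_finite(2)[of "\<lambda>x. case x of (m, r) \<Rightarrow> u m r * v (fst z - m) (snd z - r)"]
      conv_amp_eq[of u v "fst z" "snd z"]
    by (simp add: amp_def product_def)
next
  case False
  \<comment> \<open>Without convergence \<open>infsum\<close> may return its default value, but the
    bound is then trivial.\<close>
  then have "conv (amp u) (amp v) z = top" using less_top by blast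
  then show ?thesis by simp
qed

lemma zero_mean_amp_proj: "zero_mean (amp (proj_mean_zero u))"
  by (simp add: zero_mean_def amp_def proj_mean_zero_def)

lemma freq_mult_amp_proj_le: "freq_mult s (amp (proj_mean_zero u)) x \<le> freq_mult s (amp u) x"
  by (auto simp: freq_mult_def amp_def proj_mean_zero_def)

text \<open>All weights are positive, so no single term of a finite sum can be infinite. Applied to
  a convolution, this yields convergence at every frequency pair.\<close>

lemma Xsq_finite_imp_finite:
  assumes "Xsq b (freq_mult s F) < top"
  shows "F x < top"
proof -
  have "(wt (modulation x) b * freq_mult s F x)\<^sup>2 \<le> Xsq b (freq_mult s F)"
    unfolding Xsq_def by (rule nn_integral_ge_point) simp
  then have "(wt (modulation x) b * freq_mult s F x)\<^sup>2 < top" using assms by simp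
  then show ?thesis
    by (cases "F x = top") (simp_all add: freq_mult_def power2_eq_square ennreal_mult_top less_top)
qed

theorem theorem1p3:
  fixes s :: real
  assumes "s \<ge> 1/2"
  shows "\<exists>C::real. C \<ge> 0 \<and>
    (\<forall>u1 \<in> Z_space (s - 1) (1/2). \<forall>u2 \<in> Z_space (s - 1) (1/2).
       product_defined (proj_mean_zero u1) (proj_mean_zero u2) \<and>
       Z_norm s (-1/2) (product (proj_mean_zero u1) (proj_mean_zero u2))
         \<le> ennreal C *
            (Z_norm (s - 1) (1/2) u1 * Z_norm (s - 1) (1/3) u2
             + Z_norm (s - 1) (1/3) u1 * Z_norm (s - 1) (1/2) u2))"
proof -
  obtain K where K: "K < top" and est: "\<And>F G F' G' H P. zero_mean F \<Longrightarrow> zero_mean G \<Longrightarrow>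
      F' = freq_mult (s - 1) F \<Longrightarrow> G' = freq_mult (s - 1) G \<Longrightarrow> H = freq_mult s (conv F G) \<Longrightarrow>
      P = Xsq (1/2) F' * Xsq (1/3) G' + Xsq (1/3) F' * Xsq (1/2) G' \<Longrightarrow>
      Xsq (-1/2) H \<le> K * P \<and> Ysq (-1) H \<le> K * (P + Ysq 0 F' * Ysq (-1/6) G')"
    using bilinear_estimates[OF assms] unfolding Let_def by auto
  obtain k where k: "K = ennreal k" "0 \<le> k" using K by (cases K) auto
  \<comment> \<open>Any \<open>c\<close> with \<open>3 * k \<le> c\<^sup>2\<close> will do; this one
    avoids a square root. The 3 adds up the bounds \<open>2 * Q\<^sup>2\<close> for \<open>P\<close>
    and \<open>Q\<^sup>2\<close> for the \<open>Y\<close> product.\<close>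
  define c where "c = 3 * k + 1"
  have c: "0 \<le> c" "3 * K \<le> (ennreal c)\<^sup>2"
  proof -
    show "0 \<le> c" using k by (simp add: c_def)
    have "3 * k \<le> c\<^sup>2" using k by (simp add: c_def power2_eq_square algebra_simps)
    then have "ennreal (3 * k) \<le> ennreal (c\<^sup>2)" by (rule ennreal_leI)
    then show "3 * K \<le> (ennreal c)\<^sup>2"
      using k \<open>0 \<le> c\<close> by (simp only: ennreal_mult' ennreal_power) simp
  qed
  show ?thesis
  proof (intro exI[of _ "2 * c"] conjI ballI)
    show "0 \<le> 2 * c" using c by simp
    fix u1 u2 assume u: "u1 \<in> Z_space (s - 1) (1/2)" "u2 \<in> Z_space (s - 1) (1/2)"
    define p1 p2 where "p1 = proj_mean_zero u1" and "p2 = proj_mean_zero u2"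
    define F' G' H where "F' = freq_mult (s - 1) (amp p1)" and "G' = freq_mult (s - 1) (amp p2)"
      and "H = freq_mult s (conv (amp p1) (amp p2))"
    define P where "P = Xsq (1/2) F' * Xsq (1/3) G' + Xsq (1/3) F' * Xsq (1/2) G'"
    note est' = est[OF zero_mean_amp_proj zero_mean_amp_proj, of F' u1 G' u2 H P,
        folded p1_def p2_def, OF F'_def G'_def H_def P_def]
    have X1: "Xsq b F' \<le> (X_norm (s - 1) b u1)\<^sup>2" and X2: "Xsq b G' \<le> (X_norm (s - 1) b u2)\<^sup>2"
      and Y1: "Ysq b F' \<le> (Y_norm (s - 1) b u1)\<^sup>2" and Y2: "Ysq b G' \<le> (Y_norm (s - 1) b u2)\<^sup>2" for b
      unfolding X_norm_power2 Y_norm_power2 F'_def G'_def p1_def p2_def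
      by (intro Xsq_mono Ysq_mono freq_mult_amp_proj_le)+
    define Z1 Z2 z1 z2 where "Z1 = Z_norm (s - 1) (1/2) u1" and "Z2 = Z_norm (s - 1) (1/2) u2"
      and "z1 = Z_norm (s - 1) (1/3) u1" and "z2 = Z_norm (s - 1) (1/3) u2"
    \<comment> \<open>\<open>Q\<close> is the bracket on the right of the claim; each of its two
      products is at most \<open>Q\<close>, which turns the squared estimates into multiples of
      \<open>Q\<^sup>2\<close>.\<close>
    define Q where "Q = Z1 * z2 + z1 * Z2"
    have XZ: "Xsq (1/2) F' \<le> Z1\<^sup>2" "Xsq (1/2) G' \<le> Z2\<^sup>2" "Xsq (1/3) F' \<le> z1\<^sup>2" "Xsq (1/3) G' \<le> z2\<^sup>2"
      unfolding Z1_def Z2_def z1_def z2_def Z_norm_def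
      by (rule order_trans[OF X1] order_trans[OF X2]; intro power2_mono_ennreal; simp)+
    have "Ysq 0 F' \<le> Z1\<^sup>2"
      using Y1[of 0] unfolding Z1_def Z_norm_def
      by (rule order_trans) (intro power2_mono_ennreal, simp)
    moreover have "Ysq (-1/6) G' \<le> z2\<^sup>2"
      using Y2[of "-1/6"] unfolding z2_def Z_norm_def
      by (rule order_trans) (intro power2_mono_ennreal, simp)
    ultimately have YQ: "Ysq 0 F' * Ysq (-1/6) G' \<le> Q\<^sup>2"
      using mult_mono[of "Ysq 0 F'" "Z1\<^sup>2" "Ysq (-1/6) G'" "z2\<^sup>2"] power2_mono_ennreal[of "Z1 * z2" Q]
      by (simp add: Q_def power_mult_distrib)
    have PQ: "P \<le> 2 * Q\<^sup>2"
    proof -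
      have "P \<le> (Z1 * z2)\<^sup>2 + (z1 * Z2)\<^sup>2"
        unfolding P_def power_mult_distrib by (intro add_mono mult_mono XZ) auto
      also have "\<dots> \<le> Q\<^sup>2 + Q\<^sup>2" by (intro add_mono power2_mono_ennreal) (auto simp: Q_def)
      finally show ?thesis by (simp add: mult_2)
    qed
    have le: "K * R \<le> (ennreal c * Q)\<^sup>2" if "R \<le> 3 * Q\<^sup>2" for R
    proof -
      have "K * R \<le> 3 * K * Q\<^sup>2" using mult_left_mono[OF that, of K] by (simp add: mult_ac)
      also have "\<dots> \<le> (ennreal c)\<^sup>2 * Q\<^sup>2" by (intro mult_right_mono c) simp
      finally show ?thesis by (simp add: power_mult_distrib)
    qed
    have XH: "Xsq (-1/2) H \<le> (ennreal c * Q)\<^sup>2"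
    proof -
      have "P \<le> 3 * Q\<^sup>2" using PQ by (rule order_trans) (intro mult_right_mono, simp_all)
      then show ?thesis using est' le order_trans by blast
    qed
    have YH: "Ysq (-1) H \<le> (ennreal c * Q)\<^sup>2"
    proof -
      have "P + Ysq 0 F' * Ysq (-1/6) G' \<le> 2 * Q\<^sup>2 + 1 * Q\<^sup>2"
        using YQ PQ by (intro add_mono) simp_all
      also have "\<dots> = 3 * Q\<^sup>2" unfolding distrib_right[symmetric] by simp
      finally show ?thesis using est' le order_trans by blast
    qed
    have Hprod: "freq_mult s (amp (product p1 p2)) z \<le> H z" for z
      unfolding H_def freq_mult_def by (intro mult_left_mono amp_product_le) simp
    have "X_norm s (-1/2) (product p1 p2) \<le> ennreal c * Q"
      by (rule power2_le_imp_le_ennreal) (metis X_norm_power2 Xsq_mono Hprod XH order_trans)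
    moreover have "Y_norm s (-1) (product p1 p2) \<le> ennreal c * Q"
      by (rule power2_le_imp_le_ennreal) (metis Y_norm_power2 Ysq_mono Hprod YH order_trans)
    \<comment> \<open>The \<open>X\<close> and \<open>Y\<close> parts contribute
      \<open>ennreal c * Q\<close> each, hence the witness \<open>2 * c\<close>.\<close>
    ultimately have "Z_norm s (-1/2) (product p1 p2) \<le> ennreal c * Q + ennreal c * Q"
      unfolding Z_norm_def by (intro add_mono) simp_all
    also have "\<dots> = ennreal (2 * c) * Q"
      using c by (simp add: ennreal_mult' mult.assoc flip: mult_2)
    finally show "Z_norm s (-1/2) (product (proj_mean_zero u1) (proj_mean_zero u2))
         \<le> ennreal (2 * c) *
            (Z_norm (s - 1) (1/2) u1 * Z_norm (s - 1) (1/3) u2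
             + Z_norm (s - 1) (1/3) u1 * Z_norm (s - 1) (1/2) u2)"
      by (simp only: p1_def p2_def Q_def Z1_def Z2_def z1_def z2_def)
    \<comment> \<open>Membership in the space gives finiteness at exponent 1/2, and monotonicity
      passes it to 1/3. Finite \<open>P\<close> makes \<open>Xsq (-1/2) H\<close> finite, so all
      convolution sums converge absolutely.\<close>
    have "P < top"
    proof -
      have "Z1\<^sup>2 < top" "Z2\<^sup>2 < top"
        using u by (simp_all add: Z_space_def Z1_def Z2_def power2_eq_square ennreal_mult_less_top)
      then have "Xsq (1/2) F' < top" "Xsq (1/2) G' < top"
        using XZ(1,2) by (auto intro: le_less_trans)
      moreover from this have "Xsq (1/3) F' < top" "Xsq (1/3) G' < top"
        using Xsq_mono_exp[of "1/3" "1/2"] by (auto intro: le_less_trans)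
      ultimately show ?thesis by (simp add: P_def ennreal_mult_less_top)
    qed
    then have "Xsq (-1/2) H < top"
      using est' K by (auto simp: ennreal_mult_less_top intro: le_less_trans)
    then show "product_defined (proj_mean_zero u1) (proj_mean_zero u2)"
      unfolding H_def p1_def p2_def
      by (intro product_defined_if_conv_finite) (rule Xsq_finite_imp_finite)
  qed
qed

end
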